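(* Let $q$ be a prime power, $S\subseteq\mathbb F_q^n$ nonempty, $1\le b\le n$, $0<\tau\le1$, and $0<\delta<1$, and put $\mu=|S|/q^b$. If $$\mu\ge\frac{32\,q\,2^b}{\tau^2\delta},$$ then $\beta_S(b,\tau)<\delta$. Under the same hypothesis, a uniformly random $b\times n$ matrix over $\mathbb F_q$ (not only a uniformly random surjection) is $\tau$-unbalanced with probability less than $\delta$.
   Context: Let $S\subseteq\mathbb F_q^n$ be nonempty and $\mu=|S|/q^b$. A linear map $L:\mathbb F_q^n\to\mathbb F_q^b$ (equivalently a $b\times n$ matrix over $\mathbb F_q$, not necessarily of full rank) is called $\tau$-balanced (with respect to $S$) if $(1-\tau)\mu\le|S\cap L^{-1}(y)|\le(1+\tau)\mu$ for every $y\in\mathbb F_q^b$, and $\tau$-unbalanced otherwise. $\beta_S(b,\tau)$ denotes the proportion of $\tau$-unbalanced maps among all surjective linear maps $\mathbb F_q^n\to\mathbb F_q^b$. *)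

theory Defs
  imports "HOL-Analysis.Analysis" "HOL-Probability.Probability"
begin

text \<open>
  A finite field of order \<open>q\<close> is a type \<open>'a\<close> of sort \<open>{field, finite}\<close> with \<open>q = CARD('a)\<close>, and
  the spaces of dimension \<open>n\<close> and \<open>b\<close> over it are \<open>'a ^ 'n\<close> and \<open>'a ^ 'b\<close> with \<open>n = CARD('n)\<close>
  and \<open>b = CARD('b)\<close>.  The target dimension \<open>b\<close> is not visible in \<open>S\<close>, so \<open>mean_fibre\<close> and
  \<open>unbalanced_proportion\<close> take it as a type token.
\<close>

text \<open>The quantity \<open>\<mu> = |S| / q^b\<close>.\<close>

definition mean_fibre :: "('a::{field,finite} ^ 'n::finite) set \<Rightarrow> 'b::finite itself \<Rightarrow> real" where
  "mean_fibre S _ = real (card S) / real CARD('a) ^ CARD('b)"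

definition balanced ::
    "('a::{field,finite} ^ 'n::finite) set \<Rightarrow> real \<Rightarrow> ('a ^ 'n \<Rightarrow> 'a ^ 'b::finite) \<Rightarrow> bool" where
  "balanced S \<tau> L \<longleftrightarrow>
     (\<forall>y. (1 - \<tau>) * mean_fibre S TYPE('b) \<le> real (card (S \<inter> L -` {y})) \<and>
          real (card (S \<inter> L -` {y})) \<le> (1 + \<tau>) * mean_fibre S TYPE('b))"

definition linear_surjections :: "('a::{field,finite} ^ 'n::finite \<Rightarrow> 'a ^ 'b::finite) set" where
  "linear_surjections = {L. Vector_Spaces.linear (*s) (*s) L \<and> surj L}"

text \<open>
  The quantity \<open>\<beta>\<^sub>S(b, \<tau>)\<close>; the denominator is nonzero exactly when \<open>b \<le> n\<close>.
\<close>

definition unbalanced_proportion ::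
    "('a::{field,finite} ^ 'n::finite) set \<Rightarrow> 'b::finite itself \<Rightarrow> real \<Rightarrow> real" where
  "unbalanced_proportion S _ \<tau> =
     real (card {L \<in> (linear_surjections :: ('a ^ 'n \<Rightarrow> 'a ^ 'b) set). \<not> balanced S \<tau> L}) /
     real (card (linear_surjections :: ('a ^ 'n \<Rightarrow> 'a ^ 'b) set))"

end

theory Submission
  imports Defs
begin

text \<open>
  A union bound over the \<open>q\<^sup>b\<close> fibres would ask for \<open>\<mu>\<close> of size \<open>q\<^sup>b\<close>. The saving comes from
  passing to dimension \<open>b + 1\<close> and reading the problem as a Kakeya problem.

  Let \<open>L\<close> be unbalanced at \<open>y\<close>, and add a random functional \<open>l\<close> to obtain a map \<open>M\<close> to dimension
  \<open>b + 1\<close>. The exceptional fibre of \<open>L\<close> is cut into \<open>q\<close> fibres of \<open>M\<close>, lying over a line. Their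
  sizes concentrate, so usually nearly all of them deviate from the global mean \<open>\<mu> / q\<close> by a
  relative error of at least \<open>\<tau> / 2\<close> (\<open>unusual_fibre_has_unusual_parts\<close>). Let \<open>E\<close> be the set of
  all points whose fibre under \<open>M\<close> deviates that much. By Chebyshev's inequality the expected
  density of \<open>E\<close> is at most \<open>4 q / (\<tau>\<^sup>2 \<mu>) \<le> \<delta> / (8 \<cdot> 2\<^sup>b)\<close>, with no union bound
  (\<open>fibre_second_moment\<close>). Since \<open>M\<close> projected along a direction \<open>(d, 1)\<close> is again a uniformly
  random \<open>b \<times> n\<close> matrix, every direction has a line nearly inside \<open>E\<close> with a probability
  comparable to that of being unbalanced.

  A set that contains a line in a proportion \<open>p\<close> of the directions of dimension \<open>N\<close> has density
  at least about \<open>p / 2\<^sup>N\<close>, which with \<open>N = b + 1\<close> gives the claim. For the constant \<open>2\<^sup>N\<close>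
  polynomials vanishing to high order are needed, and the dependence on \<open>p\<close> must be linear. Both
  are achieved by writing forms in an explicit Newton basis, whose elements are labelled by a
  direction \<open>d\<close> and an order of differentiation such that the corresponding derivatives at
  infinity are triangular (\<open>newton_node_order\<close>). Restricting to the basis elements labelled by
  directions of rich lines, that is, lines with many points in \<open>E\<close>, yields
  \<open>kakeya_multiplicity_bound\<close>, and averaging over \<open>M\<close> yields \<open>kakeya_average\<close>, where all labels
  are equally likely.

  The computation gives the probability bound \<open>8 \<delta> / 9\<close> for all matrices
  (\<open>unbalanced_matrices_bound\<close>). The proportion of non-surjective matrices is at most \<open>1 / 64\<close>,
  so conditioning on surjectivity costs a factor of at most \<open>64 / 63\<close>, which leaves
  \<open>\<beta>\<^sub>S(b, \<tau>) < \<delta>\<close>.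
\<close>

section \<open>Newton products over periodically repeated nodes\<close>

text \<open>
  With \<open>t\<close> the indeterminate of the coefficient ring and \<open>Y\<close> the outer one, this is
  \<open>(x + Y - f 0 t) \<cdots> (x + Y - f (n - 1) t)\<close>: the homogenised Newton product, expanded around
  \<open>x\<close>. Its coefficient at \<open>Y\<^sup>\<beta>\<close> is the Hasse derivative of order \<open>\<beta>\<close> at \<open>x\<close>, which is the notion
  of derivative that still detects multiplicities in positive characteristic.
\<close>

definition newton_poly :: "(nat \<Rightarrow> 'a::field) \<Rightarrow> nat \<Rightarrow> 'a poly \<Rightarrow> 'a poly poly" where
  "newton_poly f n x = (\<Prod>k<n. [:x - [:0, f k:], 1:])"

lemma degree_newton_poly: "degree (newton_poly f n x) = n"
  unfolding newton_poly_def by (subst degree_prod_eq_sum_degree) auto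

lemma coeff_newton_poly_eq_0: "n < \<beta> \<Longrightarrow> coeff (newton_poly f n x) \<beta> = 0"
  by (simp add: coeff_eq_0 degree_newton_poly)

lemma newton_poly_Suc: "newton_poly f (Suc n) x = newton_poly f n x * [:x - [:0, f n:], 1:]"
  by (simp add: newton_poly_def)

lemma coeff_times_monic_linear:
  fixes p :: "'r::comm_ring_1 poly"
  shows "coeff (p * [:a, 1:]) 0 = a * coeff p 0"
    and "coeff (p * [:a, 1:]) (Suc k) = a * coeff p (Suc k) + coeff p k"
  by (simp_all add: mult.commute)

text \<open>
  On a line \<open>x = y + t d\<close> every factor \<open>x + Y - f k t\<close> has \<open>t\<close>-leading coefficient \<open>d - f k\<close>, so
  the top coefficient in \<open>t\<close> of a Hasse derivative along the line forgets the base point \<open>y\<close> and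
  is the same Hasse derivative of the dehomogenised product at the direction \<open>d\<close>. This is how
  information about a line is transported to its point at infinity.
\<close>

lemma newton_poly_leading_part:
  assumes "\<beta> \<le> n"
  shows "degree (coeff (newton_poly f n [:y, d:]) \<beta>) \<le> n - \<beta> \<and>
    coeff (coeff (newton_poly f n [:y, d:]) \<beta>) (n - \<beta>) = coeff (\<Prod>k<n. [:d - f k, 1:]) \<beta>"
  using assms
proof (induction n arbitrary: \<beta>)
  case 0
  then show ?case by (simp add: newton_poly_def)
next
  case (Suc n)
  have lin: "[:y, d:] - [:0, f n:] = [:y, d - f n:]" by simp
  have step: "degree ([:y, d - f n:] * g) \<le> Suc m \<and>
     coeff ([:y, d - f n:] * g) (Suc m) = (d - f n) * coeff g m"
    if "degree g \<le> m" for g :: "'a poly" and m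
  proof -
    have "degree ([:y, d - f n:] * g) \<le> degree [:y, d - f n:] + degree g" by (rule degree_mult_le)
    also have "\<dots> \<le> Suc m" using that by simp
    moreover have "coeff g (Suc m) = 0" using that by (intro coeff_eq_0) simp
    ultimately show ?thesis by (simp add: mult_pCons_left)
  qed
  show ?case
  proof (cases \<beta>)
    case 0
    then show ?thesis
      using step[of "coeff (newton_poly f n [:y, d:]) 0" n] Suc.IH[of 0]
      unfolding newton_poly_Suc lin by (simp add: coeff_times_monic_linear)
  next
    case (Suc \<gamma>)
    with Suc.prems have \<gamma>: "\<gamma> \<le> n" by simp
    show ?thesis
    proof (cases "Suc \<gamma> \<le> n")
      case True
      then have "n - \<gamma> = Suc (n - Suc \<gamma>)" by simp
      with True show ?thesis
        using step[of "coeff (newton_poly f n [:y, d:]) (Suc \<gamma>)" "n - Suc \<gamma>"] Suc.IH[of \<gamma>] Suc.IH[of "Suc \<gamma>"]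
        unfolding newton_poly_Suc lin \<open>\<beta> = Suc \<gamma>\<close>
        by (simp add: coeff_times_monic_linear degree_add_le del: mult_pCons_left)
    next
      case False
      then have "\<gamma> = n" using \<gamma> by simp
      have "degree (\<Prod>k<n. [:d - f k, 1:]) = n" by (subst degree_prod_eq_sum_degree) auto
      then have "coeff (\<Prod>k<n. [:d - f k, 1:]) (Suc n) = 0" by (intro coeff_eq_0) simp
      then show ?thesis
        using Suc.IH[of n]
        unfolding newton_poly_Suc lin \<open>\<beta> = Suc \<gamma>\<close> \<open>\<gamma> = n\<close>
        by (simp add: coeff_times_monic_linear coeff_newton_poly_eq_0)
    qed
  qed
qed

lemma newton_poly_shift:
  "newton_poly f n (x + h) = pcompose (newton_poly f n x) [:h, 1:]"
  by (simp add: newton_poly_def pcompose_prod pcompose_pCons algebra_simps)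

lemma pcompose_pow: "pcompose (p ^ n) r = pcompose p r ^ n"
  for p :: "'r::comm_ring_1 poly"
  by (induction n) (simp_all add: pcompose_1 pcompose_mult)

lemma coeff_pcompose_shift:
  fixes p :: "'r::comm_ring_1 poly"
  assumes "degree p \<le> G"
  shows "coeff (pcompose p [:h, 1:]) \<beta> = (\<Sum>n\<le>G. of_nat (n choose \<beta>) * h ^ (n - \<beta>) * coeff p n)"
proof -
  have "pcompose p [:h, 1:] = (\<Sum>n\<le>G. smult (coeff p n) ([:h, 1:] ^ n))"
    by (subst (1) poly_as_sum_of_monoms'[OF assms, symmetric])
      (simp add: pcompose_sum monom_altdef pcompose_smult pcompose_pow pcompose_pCons)
  moreover have "coeff ([:h, 1:] ^ n) \<beta> = of_nat (n choose \<beta>) * h ^ (n - \<beta>)" for n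
  proof (cases "\<beta> \<le> n")
    case False
    have "degree ([:h, 1:] ^ n) \<le> degree [:h, 1:] * n" by (rule degree_power_le)
    then show ?thesis using False by (simp add: coeff_eq_0 binomial_eq_0)
  qed (simp add: coeff_linear_poly_power)
  ultimately show ?thesis
    by (simp add: coeff_sum mult_ac)
qed

lemma coeff_newton_poly_shift:
  assumes "n \<le> G"
  shows "coeff (newton_poly f n (x + h)) \<beta>
    = (\<Sum>\<nu>\<le>G. of_nat (\<nu> choose \<beta>) * h ^ (\<nu> - \<beta>) * coeff (newton_poly f n x) \<nu>)"
  unfolding newton_poly_shift using assms by (intro coeff_pcompose_shift) (simp add: degree_newton_poly)

lemma card_residue_class_below:
  assumes "0 < (q::nat)"
  shows "card {k. k < \<alpha> \<and> k mod q = \<alpha> mod q} = \<alpha> div q"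
proof -
  have "{k. k < \<alpha> \<and> k mod q = \<alpha> mod q} = (\<lambda>i. \<alpha> mod q + q * i) ` {..<\<alpha> div q}" (is "?L = ?R")
  proof
    show "?L \<subseteq> ?R"
    proof
      fix k assume k: "k \<in> ?L"
      then have eq: "k = \<alpha> mod q + q * (k div q)"
        using mod_mult_div_eq[of k q] by simp
      moreover have "k div q < \<alpha> div q"
      proof (rule ccontr)
        assume "\<not> k div q < \<alpha> div q"
        then have "q * (\<alpha> div q) \<le> q * (k div q)" by simp
        then have "\<alpha> \<le> k" using eq mod_mult_div_eq[of \<alpha> q] by linarith
        then show False using k by simp
      qed
      ultimately show "k \<in> ?R" by blast
    qed
    show "?R \<subseteq> ?L"
    proof
      fix k assume "k \<in> ?R"
      then obtain i where i: "i < \<alpha> div q" "k = \<alpha> mod q + q * i" by blast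
      have "q * i < q * (\<alpha> div q)" using i assms by simp
      then have "k < \<alpha>" using i mod_mult_div_eq[of \<alpha> q] by linarith
      then show "k \<in> ?L" using i by simp
    qed
  qed
  moreover have "inj_on (\<lambda>i. \<alpha> mod q + q * i) {..<\<alpha> div q}" using assms by (auto simp: inj_on_def)
  ultimately show ?thesis by (simp add: card_image)
qed

text \<open>
  The nodes run through the field again and again with period \<open>q\<close>. Before position \<open>\<alpha>\<close> the node
  of index \<open>\<alpha>\<close> has been used exactly \<open>\<alpha> div q\<close> times, and more often before any later position.
  Hence the functional that takes the Hasse derivative of order \<open>\<alpha> div q\<close> at node \<open>\<alpha>\<close> is nonzero
  on the Newton product of length \<open>\<alpha>\<close> and kills all longer ones: these functionals are
  triangular with respect to the Newton basis.
\<close>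

lemma newton_node_order:
  fixes f :: "nat \<Rightarrow> 'a::field"
  assumes q: "0 < q" and inj: "inj_on f {..<q}"
  defines "\<phi> \<equiv> \<lambda>k. f (k mod q)"
  shows "\<alpha> < n \<Longrightarrow> coeff (\<Prod>k<n. [:\<phi> \<alpha> - \<phi> k, 1:]) (\<alpha> div q) = 0"
    and "coeff (\<Prod>k<\<alpha>. [:\<phi> \<alpha> - \<phi> k, 1:]) (\<alpha> div q) \<noteq> 0"
proof -
  have eq: "\<phi> \<alpha> = \<phi> k \<longleftrightarrow> k mod q = \<alpha> mod q" for k
    unfolding \<phi>_def using inj q by (auto simp: inj_on_def)
  define Z where "Z n = {k. k < n \<and> k mod q = \<alpha> mod q}" for n
  have fin: "finite (Z n)" for n unfolding Z_def by simp
  have split: "(\<Prod>k<n. [:\<phi> \<alpha> - \<phi> k, 1:]) = monom 1 (card (Z n)) * (\<Prod>k\<in>{..<n} - Z n. [:\<phi> \<alpha> - \<phi> k, 1:])" for n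
  proof -
    have "(\<Prod>k<n. [:\<phi> \<alpha> - \<phi> k, 1:]) = (\<Prod>k\<in>{..<n} - Z n. [:\<phi> \<alpha> - \<phi> k, 1:]) * (\<Prod>k\<in>Z n. [:\<phi> \<alpha> - \<phi> k, 1:])"
      by (rule prod.subset_diff) (auto simp: Z_def)
    also have "(\<Prod>k\<in>Z n. [:\<phi> \<alpha> - \<phi> k, 1:]) = (\<Prod>k\<in>Z n. [:0, 1:])"
      by (rule prod.cong) (use eq in \<open>auto simp: Z_def\<close>)
    also have "\<dots> = monom 1 (card (Z n))" by (simp add: monom_altdef)
    finally show ?thesis by (simp add: mult.commute)
  qed
  have cZ: "card (Z \<alpha>) = \<alpha> div q" unfolding Z_def by (rule card_residue_class_below[OF q])
  show "coeff (\<Prod>k<n. [:\<phi> \<alpha> - \<phi> k, 1:]) (\<alpha> div q) = 0" if "\<alpha> < n"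
  proof -
    have "insert \<alpha> (Z \<alpha>) \<subseteq> Z n" using that by (auto simp: Z_def)
    then have "card (insert \<alpha> (Z \<alpha>)) \<le> card (Z n)" by (intro card_mono fin)
    then have "\<alpha> div q < card (Z n)" using cZ fin by (simp add: Z_def)
    then show ?thesis by (simp add: split coeff_monom_mult)
  qed
  show "coeff (\<Prod>k<\<alpha>. [:\<phi> \<alpha> - \<phi> k, 1:]) (\<alpha> div q) \<noteq> 0"
  proof -
    have "coeff (\<Prod>k\<in>{..<\<alpha>} - Z \<alpha>. [:\<phi> \<alpha> - \<phi> k, 1:]) 0 = (\<Prod>k\<in>{..<\<alpha>} - Z \<alpha>. \<phi> \<alpha> - \<phi> k)"
      by (simp add: poly_0_coeff_0[symmetric] poly_prod)
    moreover have "\<dots> \<noteq> 0"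
      using eq by (auto simp: Z_def)
    ultimately show ?thesis by (simp add: split coeff_monom_mult cZ)
  qed
qed

section \<open>Forms and their Hasse derivatives along lines\<close>

text \<open>
  For \<open>p = (\<alpha>, e)\<close> this is the Hasse derivative of multi-order \<open>\<beta>\<close>, in the variables \<open>x\<^sub>i\<close> only,
  of the form \<open>t\<^sup>e \<Prod>\<^sub>i \<Prod>\<^sub>k (x\<^sub>i - f k t)\<close> with \<open>k < \<alpha>\<^sub>i\<close>, of degree \<open>|\<alpha>| + e\<close>. The last
  coordinate \<open>t\<close> is kept as an indeterminate, and the other coordinates may be polynomials in
  \<open>t\<close>, so that restriction to a line transversal to the hyperplane \<open>t = 0\<close> is just a choice of
  \<open>x\<close>.
\<close>

definition form_term ::
    "(nat \<Rightarrow> 'a::field) \<Rightarrow> ('b::finite \<Rightarrow> nat) \<times> nat \<Rightarrow> ('b \<Rightarrow> nat) \<Rightarrow> ('b \<Rightarrow> 'a poly) \<Rightarrow> 'a poly" where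
  "form_term f p \<beta> x = [:0, 1:] ^ snd p * (\<Prod>i\<in>UNIV. coeff (newton_poly f (fst p i) (x i)) (\<beta> i))"

definition form_jet ::
    "(nat \<Rightarrow> 'a::field) \<Rightarrow> (('b::finite \<Rightarrow> nat) \<times> nat \<Rightarrow> 'a) \<Rightarrow> (('b \<Rightarrow> nat) \<times> nat) set
      \<Rightarrow> ('b \<Rightarrow> nat) \<Rightarrow> ('b \<Rightarrow> 'a poly) \<Rightarrow> 'a poly" where
  "form_jet f c I \<beta> x = (\<Sum>p\<in>I. smult (c p) (form_term f p \<beta> x))"

definition exponents_below :: "nat \<Rightarrow> (('b::finite \<Rightarrow> nat) \<times> nat) set" where
  "exponents_below n = {p. sum (fst p) UNIV + snd p < n}"

lemma member_le_sum_UNIV: "\<alpha> i \<le> sum \<alpha> UNIV" for \<alpha> :: "'b::finite \<Rightarrow> nat"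
  by (rule member_le_sum) auto

lemma finite_exponents_below: "finite (exponents_below n :: (('b::finite \<Rightarrow> nat) \<times> nat) set)"
proof (rule finite_subset)
  show "(exponents_below n :: (('b \<Rightarrow> nat) \<times> nat) set) \<subseteq> (UNIV \<rightarrow>\<^sub>E {..n}) \<times> {..n}"
  proof
    fix p :: "('b \<Rightarrow> nat) \<times> nat" assume p: "p \<in> exponents_below n"
    have "fst p i \<le> n" for i
      using p member_le_sum_UNIV[of "fst p" i] by (simp add: exponents_below_def)
    with p show "p \<in> (UNIV \<rightarrow>\<^sub>E {..n}) \<times> {..n}" by (cases p) (auto simp: exponents_below_def)
  qed
  show "finite ((UNIV \<rightarrow>\<^sub>E {..n}) \<times> {..n} :: (('b \<Rightarrow> nat) \<times> nat) set)"
    by (intro finite_cartesian_product finite_PiE) auto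
qed

lemma form_term_shift:
  assumes "\<And>i. fst p i \<le> G"
  shows "form_term f p \<beta> (\<lambda>i. x i + h i) =
    (\<Sum>\<nu>\<in>UNIV \<rightarrow>\<^sub>E {..G}. (\<Prod>i\<in>UNIV. of_nat (\<nu> i choose \<beta> i) * h i ^ (\<nu> i - \<beta> i)) * form_term f p \<nu> x)"
proof -
  have "(\<Prod>i\<in>UNIV. coeff (newton_poly f (fst p i) (x i + h i)) (\<beta> i))
    = (\<Prod>i\<in>UNIV. \<Sum>n\<le>G. of_nat (n choose \<beta> i) * h i ^ (n - \<beta> i) * coeff (newton_poly f (fst p i) (x i)) n)"
    by (intro prod.cong refl coeff_newton_poly_shift assms)
  also have "\<dots> = (\<Sum>\<nu>\<in>UNIV \<rightarrow>\<^sub>E {..G}. \<Prod>i\<in>UNIV.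
      of_nat (\<nu> i choose \<beta> i) * h i ^ (\<nu> i - \<beta> i) * coeff (newton_poly f (fst p i) (x i)) (\<nu> i))"
    by (rule prod_sum_PiE) auto
  finally show ?thesis
    by (simp add: form_term_def sum_distrib_left prod.distrib mult_ac)
qed

lemma smult_sum_right: "smult a (sum g A) = (\<Sum>x\<in>A. smult a (g x))"
  by (induction A rule: infinite_finite_induct) (simp_all add: smult_add_right)

text \<open>
  Taylor's formula. What matters below is that the Taylor coefficients do not depend on the
  form, so the formula passes to linear combinations.
\<close>

lemma form_jet_shift:
  assumes "\<And>p i. p \<in> I \<Longrightarrow> fst p i \<le> G"
  shows "form_jet f c I \<beta> (\<lambda>i. x i + h i) =
    (\<Sum>\<nu>\<in>UNIV \<rightarrow>\<^sub>E {..G}. (\<Prod>i\<in>UNIV. of_nat (\<nu> i choose \<beta> i) * h i ^ (\<nu> i - \<beta> i)) * form_jet f c I \<nu> x)"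
proof -
  have "form_jet f c I \<beta> (\<lambda>i. x i + h i) = (\<Sum>p\<in>I. \<Sum>\<nu>\<in>UNIV \<rightarrow>\<^sub>E {..G}.
      (\<Prod>i\<in>UNIV. of_nat (\<nu> i choose \<beta> i) * h i ^ (\<nu> i - \<beta> i)) * smult (c p) (form_term f p \<nu> x))"
    unfolding form_jet_def
    by (rule sum.cong) (auto simp: form_term_shift[OF assms] smult_sum_right)
  then show ?thesis
    by (subst (asm) sum.swap) (simp add: form_jet_def sum_distrib_left)
qed

text \<open>
  Vanishing to order \<open>m\<close> at a point is expressed by \<open>t\<close>-divisibility of the derivatives in the
  directions \<open>x\<^sub>i\<close>, on the vertical line through the point. A line of direction \<open>(d, 1)\<close> through
  the same point differs from the vertical one by \<open>(t - a) d\<close>, and each factor \<open>t - a\<close> produced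
  by Taylor's formula makes up for the order of vanishing lost by differentiating once more.
\<close>

lemma form_jet_vanishing_along_line:
  fixes y d :: "'b::finite \<Rightarrow> 'a::field"
  assumes "finite I"
    and van: "\<And>\<nu>. [:-a, 1:] ^ (m - sum \<nu> UNIV) dvd form_jet f c I \<nu> (\<lambda>i. [:y i + a * d i:])"
  shows "[:-a, 1:] ^ (m - sum \<beta> UNIV) dvd form_jet f c I \<beta> (\<lambda>i. [:y i, d i:])"
proof -
  \<comment> \<open>a crude common bound on the exponents, so that Taylor's formula becomes one finite sum\<close>
  define G where "G = (\<Sum>p\<in>I. sum (fst p) UNIV)"
  have G: "fst p i \<le> G" if "p \<in> I" for p i
  proof -
    have "fst p i \<le> sum (fst p) UNIV" by (rule member_le_sum_UNIV)
    also have "\<dots> \<le> G" unfolding G_def using that assms(1) by (intro member_le_sum) auto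
    finally show ?thesis .
  qed
  define h where "h i = smult (d i) [:-a, 1:]" for i
  have h_dvd: "[:-a, 1:] dvd h i" for i unfolding h_def by (rule dvd_smult) (rule dvd_refl)
  have line: "(\<lambda>i. [:y i, d i:]) = (\<lambda>i. [:y i + a * d i:] + h i)"
    by (rule ext) (simp add: h_def algebra_simps)
  have shift: "form_jet f c I \<beta> (\<lambda>i. [:y i + a * d i:] + h i) =
    (\<Sum>\<nu>\<in>UNIV \<rightarrow>\<^sub>E {..G}. (\<Prod>i\<in>UNIV. of_nat (\<nu> i choose \<beta> i) * h i ^ (\<nu> i - \<beta> i))
      * form_jet f c I \<nu> (\<lambda>i. [:y i + a * d i:]))"
    by (rule form_jet_shift) (rule G)
  show ?thesis
    unfolding line shift
  proof (rule dvd_sum)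
    fix \<nu> :: "'b \<Rightarrow> nat"
    let ?T = "\<Prod>i\<in>UNIV. of_nat (\<nu> i choose \<beta> i) * h i ^ (\<nu> i - \<beta> i)"
    show "[:-a, 1:] ^ (m - sum \<beta> UNIV) dvd ?T * form_jet f c I \<nu> (\<lambda>i. [:y i + a * d i:])"
    proof (cases "\<forall>i. \<beta> i \<le> \<nu> i")
      case True
      have "(\<Prod>i\<in>UNIV. [:-a, 1:] ^ (\<nu> i - \<beta> i)) dvd ?T"
        by (rule prod_dvd_prod) (intro dvd_mult dvd_power_same h_dvd)
      then have "[:-a, 1:] ^ (\<Sum>i\<in>UNIV. \<nu> i - \<beta> i) dvd ?T" by (simp add: power_sum)
      then have big: "[:-a, 1:] ^ ((\<Sum>i\<in>UNIV. \<nu> i - \<beta> i) + (m - sum \<nu> UNIV))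
          dvd ?T * form_jet f c I \<nu> (\<lambda>i. [:y i + a * d i:])"
        using van[of \<nu>] unfolding power_add by (rule mult_dvd_mono)
      have "(\<Sum>i\<in>UNIV. \<nu> i - \<beta> i) = sum \<nu> UNIV - sum \<beta> UNIV"
        using True by (intro sum_subtractf_nat) auto
      then have "m - sum \<beta> UNIV \<le> (\<Sum>i\<in>UNIV. \<nu> i - \<beta> i) + (m - sum \<nu> UNIV)" by simp
      from dvd_trans[OF le_imp_power_dvd[OF this] big] show ?thesis .
    next
      case False
      then obtain i where "\<nu> i < \<beta> i" by (auto simp: not_le)
      then have "of_nat (\<nu> i choose \<beta> i) * h i ^ (\<nu> i - \<beta> i) = 0" by (simp add: binomial_eq_0)
      then have "?T = 0" by (intro prod_zero) auto
      then show ?thesis by (simp only: mult_zero_left dvd_0_right)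
    qed
  qed
qed

lemma coeff_mult_top:
  fixes p q :: "'r::comm_semiring_0 poly"
  assumes "degree p \<le> m" "degree q \<le> n"
  shows "coeff (p * q) (m + n) = coeff p m * coeff q n"
proof -
  have "coeff (p * q) (m + n) = (\<Sum>i\<le>m + n. coeff p i * coeff q (m + n - i))"
    by (rule coeff_mult)
  also have "\<dots> = (\<Sum>i\<in>{m}. coeff p i * coeff q (m + n - i))"
  proof (rule sum.mono_neutral_right)
    show "\<forall>i\<in>{..m + n} - {m}. coeff p i * coeff q (m + n - i) = 0"
    proof
      fix i assume "i \<in> {..m + n} - {m}"
      then have "i > m \<or> m + n - i > n" by auto
      then show "coeff p i * coeff q (m + n - i) = 0"
        using assms by (auto simp: coeff_eq_0)
    qed
  qed auto
  finally show ?thesis by simp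
qed

lemma coeff_prod_top:
  fixes p :: "'i \<Rightarrow> 'r::comm_semiring_1 poly"
  assumes "finite A" "\<And>i. i \<in> A \<Longrightarrow> degree (p i) \<le> n i"
  shows "degree (prod p A) \<le> sum n A \<and> coeff (prod p A) (sum n A) = (\<Prod>i\<in>A. coeff (p i) (n i))"
  using assms
proof (induction A rule: finite_induct)
  case (insert a A)
  then have d: "degree (p a) \<le> n a" "degree (prod p A) \<le> sum n A" by auto
  have "degree (p a * prod p A) \<le> degree (p a) + degree (prod p A)" by (rule degree_mult_le)
  also have "\<dots> \<le> n a + sum n A" using d by simp
  finally show ?case using insert coeff_mult_top[OF d] by simp
qed simp

text \<open>
  Each derivative lowers the degree in \<open>t\<close> along the line by one. So in the top degree only
  forms of full degree \<open>j\<close> survive, each through the derivative of its dehomogenisation at the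
  direction \<open>d\<close>.
\<close>

lemma form_term_leading_part:
  fixes y d :: "'b::finite \<Rightarrow> 'a::field"
  assumes "sum (fst p) UNIV + snd p \<le> j" and "sum \<beta> UNIV \<le> j"
  shows "degree (form_term f p \<beta> (\<lambda>i. [:y i, d i:])) \<le> j - sum \<beta> UNIV \<and>
    coeff (form_term f p \<beta> (\<lambda>i. [:y i, d i:])) (j - sum \<beta> UNIV) =
      (if sum (fst p) UNIV + snd p = j
       then \<Prod>i\<in>UNIV. coeff (\<Prod>k<fst p i. [:d i - f k, 1:]) (\<beta> i) else 0)"
proof (cases "\<forall>i. \<beta> i \<le> fst p i")
  case True
  let ?c = "\<lambda>i. coeff (newton_poly f (fst p i) [:y i, d i:]) (\<beta> i)"
  let ?n = "\<Sum>i\<in>UNIV. fst p i - \<beta> i"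
  have n: "?n = sum (fst p) UNIV - sum \<beta> UNIV" "sum \<beta> UNIV \<le> sum (fst p) UNIV"
    using True by (auto intro: sum_subtractf_nat sum_mono)
  have top: "degree (prod ?c UNIV) \<le> ?n \<and> coeff (prod ?c UNIV) ?n
      = (\<Prod>i\<in>UNIV. coeff (\<Prod>k<fst p i. [:d i - f k, 1:]) (\<beta> i))"
  proof -
    have "degree (?c i) \<le> fst p i - \<beta> i \<and>
        coeff (?c i) (fst p i - \<beta> i) = coeff (\<Prod>k<fst p i. [:d i - f k, 1:]) (\<beta> i)" for i
      using newton_poly_leading_part True by blast
    then show ?thesis using coeff_prod_top[of UNIV ?c "\<lambda>i. fst p i - \<beta> i"] by simp
  qed
  have eq: "form_term f p \<beta> (\<lambda>i. [:y i, d i:]) = monom 1 (snd p) * prod ?c UNIV"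
    by (simp add: form_term_def monom_altdef)
  have "degree (form_term f p \<beta> (\<lambda>i. [:y i, d i:])) \<le> degree (monom (1::'a) (snd p)) + degree (prod ?c UNIV)"
    unfolding eq by (rule degree_mult_le)
  also have "\<dots> \<le> snd p + ?n" using top by (intro add_mono) (auto simp: degree_monom_le)
  finally have deg: "degree (form_term f p \<beta> (\<lambda>i. [:y i, d i:])) \<le> snd p + ?n" .
  have cf: "coeff (form_term f p \<beta> (\<lambda>i. [:y i, d i:])) (snd p + ?n)
      = (\<Prod>i\<in>UNIV. coeff (\<Prod>k<fst p i. [:d i - f k, 1:]) (\<beta> i))"
    unfolding eq using top by (simp add: coeff_monom_mult)
  show ?thesis
  proof (cases "sum (fst p) UNIV + snd p = j")
    case True
    then have "snd p + ?n = j - sum \<beta> UNIV" using n by linarith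
    then show ?thesis using deg cf True by simp
  next
    case False
    then have "snd p + ?n < j - sum \<beta> UNIV" using n assms by linarith
    then show ?thesis using deg False by (simp add: coeff_eq_0)
  qed
next
  case False
  then obtain i where i: "fst p i < \<beta> i" by (auto simp: not_le)
  have "(\<Prod>i\<in>UNIV. coeff (newton_poly f (fst p i) [:y i, d i:]) (\<beta> i)) = 0"
    using coeff_newton_poly_eq_0[OF i] by (intro prod_zero) auto
  moreover have "coeff (\<Prod>k<fst p i. [:d i - f k, 1:]) (\<beta> i) = 0"
  proof (rule coeff_eq_0)
    have "degree (\<Prod>k<fst p i. [:d i - f k, 1:]) = fst p i" by (subst degree_prod_eq_sum_degree) auto
    then show "degree (\<Prod>k<fst p i. [:d i - f k, 1:]) < \<beta> i" using i by simp
  qed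
  then have "(\<Prod>i\<in>UNIV. coeff (\<Prod>k<fst p i. [:d i - f k, 1:]) (\<beta> i)) = 0"
    by (intro prod_zero) auto
  ultimately show ?thesis
    unfolding form_term_def by (simp only: mult_zero_right degree_0 coeff_0 if_cancel) simp
qed

lemma form_jet_leading_part:
  fixes y d :: "'b::finite \<Rightarrow> 'a::field"
  assumes "finite I" and deg: "\<And>p. p \<in> I \<Longrightarrow> c p \<noteq> 0 \<Longrightarrow> sum (fst p) UNIV + snd p \<le> j"
    and "sum \<beta> UNIV \<le> j"
  shows "degree (form_jet f c I \<beta> (\<lambda>i. [:y i, d i:])) \<le> j - sum \<beta> UNIV"
    and "coeff (form_jet f c I \<beta> (\<lambda>i. [:y i, d i:])) (j - sum \<beta> UNIV) =
      (\<Sum>p\<in>I. c p * (if sum (fst p) UNIV + snd p = j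
       then \<Prod>i\<in>UNIV. coeff (\<Prod>k<fst p i. [:d i - f k, 1:]) (\<beta> i) else 0))"
proof -
  have top: "degree (smult (c p) (form_term f p \<beta> (\<lambda>i. [:y i, d i:]))) \<le> j - sum \<beta> UNIV \<and>
     coeff (smult (c p) (form_term f p \<beta> (\<lambda>i. [:y i, d i:]))) (j - sum \<beta> UNIV) =
     c p * (if sum (fst p) UNIV + snd p = j
       then \<Prod>i\<in>UNIV. coeff (\<Prod>k<fst p i. [:d i - f k, 1:]) (\<beta> i) else 0)" if "p \<in> I" for p
    using form_term_leading_part[OF deg[OF that] assms(3)] by (cases "c p = 0") auto
  show "degree (form_jet f c I \<beta> (\<lambda>i. [:y i, d i:])) \<le> j - sum \<beta> UNIV"
    unfolding form_jet_def by (rule degree_sum_le) (use top assms(1) in auto)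
  show "coeff (form_jet f c I \<beta> (\<lambda>i. [:y i, d i:])) (j - sum \<beta> UNIV) =
      (\<Sum>p\<in>I. c p * (if sum (fst p) UNIV + snd p = j
       then \<Prod>i\<in>UNIV. coeff (\<Prod>k<fst p i. [:d i - f k, 1:]) (\<beta> i) else 0))"
    unfolding form_jet_def coeff_sum by (rule sum.cong) (use top in auto)
qed

lemma form_jet_diff:
  "form_jet f (\<lambda>p. c1 p - c2 p) I \<beta> x = form_jet f c1 I \<beta> x - form_jet f c2 I \<beta> x"
  by (simp add: form_jet_def smult_diff_left sum_subtractf)

text \<open>
  Vanishing to order \<open>m\<close> at one point amounts to one linear equation per exponent of total
  degree below \<open>m\<close>: the coefficients of the remainders modulo the powers of \<open>t - a\<close>. With more
  coefficients available than equations, two coefficient vectors over the finite field satisfy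
  them with the same right-hand sides, and their difference is the required one.
\<close>

lemma exists_form_vanishing:
  fixes E :: "(('a::{field,finite} ^ 'b::finite) \<times> 'a) set" and f :: "nat \<Rightarrow> 'a"
  assumes "finite I" and few: "card E * card (exponents_below m :: (('b \<Rightarrow> nat) \<times> nat) set) < card I"
  obtains c where "\<exists>p\<in>I. c p \<noteq> 0"
    and "\<And>z a \<beta>. (z, a) \<in> E \<Longrightarrow>
      [:-a, 1:] ^ (m - sum \<beta> UNIV) dvd form_jet f c I \<beta> (\<lambda>i. [:z $ i:])"
proof -
  define J :: "(('b \<Rightarrow> nat) \<times> nat) set" where "J = exponents_below m"
  define rem where "rem c z a \<beta> = form_jet f c I \<beta> (\<lambda>i. [:z $ i:]) mod [:-a, 1:] ^ (m - sum \<beta> UNIV)"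
    for c and z :: "'a ^ 'b" and a \<beta>
  define \<Phi> where "\<Phi> c = (\<lambda>w\<in>E \<times> J. coeff (rem c (fst (fst w)) (snd (fst w)) (fst (snd w))) (snd (snd w)))"
    for c
  have finJ: "finite J" unfolding J_def by (rule finite_exponents_below)
  have "{0, 1} \<subseteq> (UNIV :: 'a set)" by simp
  then have "card {0::'a, 1} \<le> CARD('a)" by (rule card_mono[rotated]) simp
  then have q: "1 < CARD('a)" by simp
  have "card (\<Phi> ` (I \<rightarrow>\<^sub>E UNIV)) \<le> card (E \<times> J \<rightarrow>\<^sub>E (UNIV :: 'a set))"
    by (rule card_mono) (auto simp: \<Phi>_def finJ intro!: finite_PiE restrict_PiE_iff[THEN iffD2] split del: if_split)
  also have "\<dots> = CARD('a) ^ (card E * card J)"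
    using finJ by (simp add: card_PiE card_cartesian_product)
  also have "\<dots> < CARD('a) ^ card I"
    using q few by (simp add: J_def)
  also have "\<dots> = card (I \<rightarrow>\<^sub>E (UNIV :: 'a set))"
    using assms(1) by (simp add: card_PiE)
  finally have "\<not> inj_on \<Phi> (I \<rightarrow>\<^sub>E UNIV)" by (rule pigeonhole)
  then obtain c1 c2 where c: "c1 \<in> I \<rightarrow>\<^sub>E UNIV" "c2 \<in> I \<rightarrow>\<^sub>E UNIV" "\<Phi> c1 = \<Phi> c2" "c1 \<noteq> c2"
    by (auto simp: inj_on_def)
  show ?thesis
  proof (rule that[of "\<lambda>p. c1 p - c2 p"])
    show "\<exists>p\<in>I. c1 p - c2 p \<noteq> 0"
      using c by (metis PiE_ext right_minus_eq)
    show "[:-a, 1:] ^ (m - sum \<beta> UNIV) dvd form_jet f (\<lambda>p. c1 p - c2 p) I \<beta> (\<lambda>i. [:z $ i:])"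
      if "(z, a) \<in> E" for z a \<beta>
    proof (cases "sum \<beta> UNIV < m")
      case True
      let ?M = "[:-a, 1:] ^ (m - sum \<beta> UNIV)"
      have degM: "degree ?M = m - sum \<beta> UNIV" by (simp add: degree_power_eq)
      have high: "coeff (rem c' z a \<beta>) e = 0" if "m - sum \<beta> UNIV \<le> e" for c' e
      proof -
        have "rem c' z a \<beta> = 0 \<or> degree (rem c' z a \<beta>) < m - sum \<beta> UNIV"
          using degree_mod_less[of ?M "form_jet f c' I \<beta> (\<lambda>i. [:z $ i:])"]
          unfolding rem_def degM by auto
        then show ?thesis using that by (auto simp: coeff_eq_0)
      qed
      have "rem c1 z a \<beta> = rem c2 z a \<beta>"
      proof (rule poly_eqI)
        fix e
        show "coeff (rem c1 z a \<beta>) e = coeff (rem c2 z a \<beta>) e"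
        proof (cases "e < m - sum \<beta> UNIV")
          case True
          then have "((z, a), (\<beta>, e)) \<in> E \<times> J" using that by (auto simp: J_def exponents_below_def)
          with fun_cong[OF c(3), of "((z, a), (\<beta>, e))"] show ?thesis by (simp add: \<Phi>_def)
        qed (simp add: high)
      qed
      then show ?thesis
        unfolding form_jet_diff rem_def by (simp add: mod_eq_dvd_iff)
    qed simp
  qed
qed

definition node_direction :: "(nat \<Rightarrow> 'a) \<Rightarrow> ('b::finite \<Rightarrow> nat) \<Rightarrow> 'a ^ 'b" where
  "node_direction f \<alpha> = (\<chi> i. f (\<alpha> i))"

section \<open>A Kakeya bound with multiplicities\<close>

text \<open>
  The method of multiplicities. If the bound failed, some nonzero combination \<open>P\<close> of the forms
  indexed by \<open>(\<alpha>, e)\<close>, with \<open>|\<alpha>| + e < u s\<close> and with the node of \<open>\<alpha>\<close> in \<open>D\<close>, would vanish to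
  order \<open>2 u - 1\<close> on \<open>E\<close>. Take a term of top degree whose \<open>\<alpha>\<close> has minimal size among these, let
  \<open>d\<close> be its node and \<open>\<beta> = \<alpha> div q\<close>, an order below \<open>u\<close>. Along the rich line of direction \<open>d\<close>
  the derivative of order \<open>\<beta>\<close> still vanishes to order \<open>u\<close> at \<open>s\<close> points, more than its degree
  permits, so it is zero. But its top coefficient is the value of the triangular functional at
  \<open>\<alpha>\<close>, which sees only the chosen term.

  Only directions in \<open>D\<close> enter as nodes. This makes the bound linear in the density of \<open>D\<close> once
  one averages over sets \<open>E\<close> for which every direction is equally likely.
\<close>

lemma kakeya_multiplicity_bound:
  fixes E :: "(('a::{field,finite} ^ 'b::finite) \<times> 'a) set" and D :: "('a ^ 'b) set"
    and g :: "nat \<Rightarrow> 'a"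
  assumes inj: "inj_on g {..<CARD('a)}"
    and s: "s \<le> CARD('a)"
    and lines: "\<And>d. d \<in> D \<Longrightarrow> \<exists>y. s \<le> card {a. (y + a *s d, a) \<in> E}"
  defines "f \<equiv> \<lambda>k. g (k mod CARD('a))"
  shows "card {p \<in> exponents_below (u * s). node_direction f (fst p) \<in> D}
    \<le> card E * card (exponents_below (2 * u - 1) :: (('b \<Rightarrow> nat) \<times> nat) set)"
proof (rule ccontr)
  define I where "I = {p \<in> exponents_below (u * s). node_direction f (fst p) \<in> D}"
  define m where "m = 2 * u - 1"
  assume "\<not> ?thesis"
  then have few: "card E * card (exponents_below m :: (('b \<Rightarrow> nat) \<times> nat) set) < card I"
    by (simp add: I_def m_def)
  have finI: "finite I" unfolding I_def by (simp add: finite_exponents_below)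
  obtain c where c: "\<exists>p\<in>I. c p \<noteq> 0"
    and van: "\<And>z a \<beta>. (z, a) \<in> E \<Longrightarrow>
      [:-a, 1:] ^ (m - sum \<beta> UNIV) dvd form_jet f c I \<beta> (\<lambda>i. [:z $ i:])"
    by (rule exists_form_vanishing[OF finI few, of f]) blast
  define deg where "deg p = sum (fst p) UNIV + snd p" for p :: "('b \<Rightarrow> nat) \<times> nat"
  \<comment> \<open>the terms of \<open>P\<close>, then those of top degree \<open>j\<close>, then one whose \<open>\<alpha>\<close> is minimal\<close>
  define I' where "I' = {p \<in> I. c p \<noteq> 0}"
  have I': "finite I'" "I' \<noteq> {}" using finI c by (auto simp: I'_def)
  define j where "j = Max (deg ` I')"
  have j_ge: "deg p \<le> j" if "p \<in> I'" for p
    unfolding j_def using that I' by (intro Max_ge) auto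
  define I'' where "I'' = {p \<in> I'. deg p = j}"
  have "j \<in> deg ` I'" unfolding j_def using I' by (intro Max_in) auto
  then have I'': "finite I''" "I'' \<noteq> {}" using I' by (auto simp: I''_def)
  obtain p where p: "p \<in> I''" and pmin: "\<And>p'. p' \<in> I'' \<Longrightarrow> sum (fst p) UNIV \<le> sum (fst p') UNIV"
    using I'' ex_min_if_finite[of "(\<lambda>p. sum (fst p) UNIV) ` I''"] by (fastforce simp: not_less)
  have pI: "p \<in> I" "c p \<noteq> 0" "deg p = j" using p by (auto simp: I''_def I'_def)
  define \<alpha> where "\<alpha> = fst p"
  define d where "d = node_direction f \<alpha>"
  have "d \<in> D" using pI by (simp add: d_def \<alpha>_def I_def)
  then obtain y where y: "s \<le> card {a. (y + a *s d, a) \<in> E}" using lines by blast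
  define A where "A = {a. (y + a *s d, a) \<in> E}"
  define \<beta> where "\<beta> i = \<alpha> i div CARD('a)" for i
  have j_less: "j < u * s" using pI by (auto simp: I_def exponents_below_def deg_def)
  have \<beta>_le: "\<beta> i \<le> \<alpha> i" for i by (simp add: \<beta>_def)
  have \<beta>_sum_\<alpha>: "sum \<beta> UNIV \<le> sum \<alpha> UNIV" by (rule sum_mono) (simp add: \<beta>_le)
  have \<alpha>_j: "sum \<alpha> UNIV \<le> j" using pI by (simp add: deg_def \<alpha>_def)
  have "CARD('a) * sum \<beta> UNIV \<le> sum \<alpha> UNIV"
    unfolding sum_distrib_left by (rule sum_mono) (simp add: \<beta>_def)
  also have "\<dots> < u * CARD('a)" using \<alpha>_j j_less s by (meson le_less_trans less_le_trans mult_le_mono2)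
  finally have \<beta>_u: "sum \<beta> UNIV < u" by (simp add: mult.commute)
  define h where "h = form_jet f c I \<beta> (\<lambda>i. [:y $ i, d $ i:])"
  have deg_le: "sum (fst p) UNIV + snd p \<le> j" if "p \<in> I" "c p \<noteq> 0" for p
    using j_ge that by (auto simp: I'_def deg_def)
  have \<beta>_j: "sum \<beta> UNIV \<le> j" using \<beta>_sum_\<alpha> \<alpha>_j by simp
  have h_deg: "degree h \<le> j - sum \<beta> UNIV"
    and h_coeff: "coeff h (j - sum \<beta> UNIV) =
      (\<Sum>p\<in>I. c p * (if sum (fst p) UNIV + snd p = j
       then \<Prod>i\<in>UNIV. coeff (\<Prod>k<fst p i. [:d $ i - f k, 1:]) (\<beta> i) else 0))"
    unfolding h_def using form_jet_leading_part[OF finI deg_le \<beta>_j, where c=c] by auto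
  have "h = 0"
  proof (rule ccontr)
    assume "h \<noteq> 0"
    have ord: "u \<le> order a h" if "a \<in> A" for a
    proof -
      have "[:-a, 1:] ^ (m - sum \<beta> UNIV) dvd h"
        unfolding h_def using van[of "y + a *s d" a] that finI
        by (intro form_jet_vanishing_along_line) (auto simp: A_def)
      moreover have "u \<le> m - sum \<beta> UNIV" using \<beta>_u by (simp add: m_def)
      ultimately show ?thesis using \<open>h \<noteq> 0\<close> by (meson order_divides order.trans)
    qed
    have "u * s \<le> u * card A" using y by (simp add: A_def)
    also have "\<dots> = (\<Sum>a\<in>A. u)" by simp
    also have "\<dots> \<le> (\<Sum>a\<in>A. order a h)" by (rule sum_mono) (rule ord)
    also have "\<dots> \<le> (\<Sum>a | poly h a = 0. order a h)"
    proof (rule sum_mono2)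
      show "A \<subseteq> {a. poly h a = 0}"
        using ord \<beta>_u \<open>h \<noteq> 0\<close> by (fastforce simp: order_root)
    qed auto
    also have "\<dots> \<le> degree h" by (rule sum_order_le_degree) fact
    finally show False using h_deg j_less by simp
  qed
  have node: "\<alpha> i < n \<Longrightarrow> coeff (\<Prod>k<n. [:d $ i - f k, 1:]) (\<beta> i) = 0"
    "coeff (\<Prod>k<\<alpha> i. [:d $ i - f k, 1:]) (\<beta> i) \<noteq> 0" for i n
    using newton_node_order[OF _ inj, of "\<alpha> i"]
    by (auto simp: d_def node_direction_def f_def \<beta>_def)
  have "coeff h (j - sum \<beta> UNIV) = (\<Sum>p'\<in>{p}. c p' * (\<Prod>i\<in>UNIV. coeff (\<Prod>k<fst p' i. [:d $ i - f k, 1:]) (\<beta> i)))"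
    unfolding h_coeff
  proof (rule sum.mono_neutral_cong_right)
    show "finite I" "{p} \<subseteq> I" using finI pI by auto
    show "\<forall>p'\<in>I - {p}. c p' * (if sum (fst p') UNIV + snd p' = j
       then \<Prod>i\<in>UNIV. coeff (\<Prod>k<fst p' i. [:d $ i - f k, 1:]) (\<beta> i) else 0) = 0"
    proof (intro ballI, rule ccontr)
      fix p' assume p': "p' \<in> I - {p}" and nz: "c p' * (if sum (fst p') UNIV + snd p' = j
       then \<Prod>i\<in>UNIV. coeff (\<Prod>k<fst p' i. [:d $ i - f k, 1:]) (\<beta> i) else 0) \<noteq> 0"
      then have "c p' \<noteq> 0" "deg p' = j"
        and prod: "(\<Prod>i\<in>UNIV. coeff (\<Prod>k<fst p' i. [:d $ i - f k, 1:]) (\<beta> i)) \<noteq> 0"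
        by (auto simp: deg_def split: if_splits)
      with p' have "p' \<in> I''" by (auto simp: I''_def I'_def)
      \<comment> \<open>by triangularity a surviving \<open>\<alpha>'\<close> lies below \<open>\<alpha>\<close> in each coordinate; by minimality it equals \<open>\<alpha>\<close>\<close>
      have le: "fst p' i \<le> \<alpha> i" for i
        using prod node(1)[of i "fst p' i"] by (force simp: not_less)
      have "fst p' = \<alpha>"
      proof (rule ccontr)
        assume "fst p' \<noteq> \<alpha>"
        then obtain i where "fst p' i < \<alpha> i" using le by (metis ext le_neq_implies_less)
        then have "sum (fst p') UNIV < sum \<alpha> UNIV"
          by (intro sum_strict_mono_ex1) (use le in auto)
        then show False using pmin[OF \<open>p' \<in> I''\<close>] by (simp add: \<alpha>_def)
      qed
      moreover have "snd p' = snd p"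
        using \<open>deg p' = j\<close> pI(3) calculation by (simp add: deg_def \<alpha>_def)
      ultimately show False using p' by (simp add: \<alpha>_def prod_eq_iff)
    qed
  qed (use pI in \<open>auto simp: deg_def\<close>)
  then have "coeff h (j - sum \<beta> UNIV) \<noteq> 0" using node(2) pI by (simp add: \<alpha>_def)
  then show False using \<open>h = 0\<close> by simp
qed

section \<open>The number of exponents of bounded degree\<close>

lemma card_functions_sum_below:
  fixes B :: "'b set"
  assumes "finite B"
  shows "finite {\<beta>::'b \<Rightarrow> nat. (\<forall>i. i \<notin> B \<longrightarrow> \<beta> i = 0) \<and> sum \<beta> B < Suc m} \<and>
    card {\<beta>::'b \<Rightarrow> nat. (\<forall>i. i \<notin> B \<longrightarrow> \<beta> i = 0) \<and> sum \<beta> B < Suc m} = (m + card B) choose card B"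
  using assms
proof (induction B arbitrary: m rule: finite_induct)
  case empty
  have "{\<beta>::'b \<Rightarrow> nat. (\<forall>i. i \<notin> {} \<longrightarrow> \<beta> i = 0) \<and> sum \<beta> {} < Suc m} = {\<lambda>_. 0}" by auto
  then show ?case by simp
next
  case (insert x B)
  define T where "T B m = {\<beta>::'b \<Rightarrow> nat. (\<forall>i. i \<notin> B \<longrightarrow> \<beta> i = 0) \<and> sum \<beta> B < Suc m}" for B m
  have IH: "finite (T B m)" "card (T B m) = (m + card B) choose card B" for m
    using insert.IH[of m] by (auto simp: T_def)
  have img: "T (insert x B) m = (\<lambda>(e, \<beta>). \<beta>(x := e)) ` (SIGMA e:{..m}. T B (m - e))" (is "?L = ?F ` ?R")
  proof
    show "?L \<subseteq> ?F ` ?R"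
    proof
      fix \<beta> assume \<beta>: "\<beta> \<in> ?L"
      have "sum (\<beta>(x := 0)) B = sum \<beta> B"
        using insert.hyps by (intro sum.cong) auto
      then have "(\<beta> x, \<beta>(x := 0)) \<in> ?R" using \<beta> insert.hyps by (auto simp: T_def)
      moreover have "\<beta> = ?F (\<beta> x, \<beta>(x := 0))" by simp
      ultimately show "\<beta> \<in> ?F ` ?R" by blast
    qed
    show "?F ` ?R \<subseteq> ?L"
    proof
      fix \<gamma> assume "\<gamma> \<in> ?F ` ?R"
      then obtain e \<beta> where e: "e \<le> m" "\<beta> \<in> T B (m - e)" and \<gamma>: "\<gamma> = \<beta>(x := e)" by auto
      have "sum \<gamma> B = sum \<beta> B"
        using insert.hyps \<gamma> by (intro sum.cong) auto
      then show "\<gamma> \<in> ?L" using e \<gamma> insert.hyps by (auto simp: T_def)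
    qed
  qed
  have inj: "inj_on ?F ?R"
  proof (rule inj_onI)
    fix p p' assume p: "p \<in> ?R" "p' \<in> ?R" "?F p = ?F p'"
    obtain e \<beta> e' \<beta>' where eq: "p = (e, \<beta>)" "p' = (e', \<beta>')" by (cases p, cases p')
    have "\<beta> x = 0" "\<beta>' x = 0" using p insert.hyps by (auto simp: T_def eq)
    moreover have fe: "(\<beta>(x := e)) i = (\<beta>'(x := e')) i" for i using p by (simp add: eq)
    have "e = e'" using fe[of x] by simp
    moreover have "\<beta> i = \<beta>' i" for i using fe[of i] calculation by (cases "i = x") auto
    ultimately show "p = p'" by (auto simp: eq)
  qed
  have "card (T (insert x B) m) = (\<Sum>e\<le>m. card (T B (m - e)))"
    unfolding img by (simp add: card_image[OF inj] card_SigmaI IH)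
  also have "\<dots> = (\<Sum>j\<le>m. card (T B j))"
    by (rule sum.reindex_bij_witness[of _ "\<lambda>j. m - j" "\<lambda>e. m - e"]) auto
  also have "\<dots> = (\<Sum>j\<le>m. (card B + j) choose card B)" by (simp add: IH add.commute)
  also have "\<dots> = (card B + m + 1) choose (card B + 1)" by (rule choose_rising_sum)
  finally have "card (T (insert x B) m) = (m + card (insert x B)) choose card (insert x B)"
    using insert.hyps by (simp add: ac_simps)
  moreover have "finite (T (insert x B) m)" unfolding img using IH by (intro finite_imageI finite_SigmaI) auto
  ultimately show ?case by (simp add: T_def)
qed

lemma card_exponents_below:
  "card (exponents_below (Suc m) :: (('b::finite \<Rightarrow> nat) \<times> nat) set) = (m + Suc CARD('b)) choose Suc CARD('b)"
proof -
  define T where "T m = {\<beta>::'b \<Rightarrow> nat. sum \<beta> UNIV < Suc m}" for m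
  have T: "finite (T m)" "card (T m) = (m + CARD('b)) choose CARD('b)" for m
    using card_functions_sum_below[of "UNIV :: 'b set" m] by (simp_all add: T_def)
  have img: "(exponents_below (Suc m) :: (('b \<Rightarrow> nat) \<times> nat) set) = prod.swap ` (SIGMA e:{..m}. T (m - e))"
    by (force simp: exponents_below_def T_def image_def)
  have "card (exponents_below (Suc m) :: (('b \<Rightarrow> nat) \<times> nat) set) = (\<Sum>e\<le>m. card (T (m - e)))"
    unfolding img by (subst card_image) (simp_all add: card_SigmaI T)
  also have "\<dots> = (\<Sum>j\<le>m. card (T j))"
    by (rule sum.reindex_bij_witness[of _ "\<lambda>j. m - j" "\<lambda>e. m - e"]) auto
  also have "\<dots> = (\<Sum>j\<le>m. (CARD('b) + j) choose CARD('b))" by (simp add: T add.commute)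
  also have "\<dots> = (CARD('b) + m + 1) choose (CARD('b) + 1)" by (rule choose_rising_sum)
  finally show ?thesis by (simp add: ac_simps)
qed

lemma power_le_binomial_fact: "Suc m ^ N \<le> ((m + N) choose N) * fact N"
proof (induction N)
  case (Suc N)
  have "Suc m ^ Suc N \<le> Suc (m + N) * (((m + N) choose N) * fact N)"
    using Suc by (simp only: power_Suc) (intro mult_mono, auto)
  also have "\<dots> = (Suc (m + N) * ((m + N) choose N)) * fact N" by (simp only: mult.assoc)
  also have "Suc (m + N) * ((m + N) choose N) = Suc N * (Suc (m + N) choose Suc N)"
    by (simp only: Suc_times_binomial_eq mult.commute)
  finally show ?case by (simp add: algebra_simps del: binomial_Suc_Suc)
qed simp

lemma exponents_below_bounds:
  fixes n :: nat
  defines "K \<equiv> card (exponents_below n :: (('b::finite \<Rightarrow> nat) \<times> nat) set)"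
  assumes "0 < n"
  shows "n ^ Suc CARD('b) \<le> K * fact (Suc CARD('b))"
    and "K * fact (Suc CARD('b)) \<le> (n + CARD('b)) ^ Suc CARD('b)"
proof -
  obtain m where n: "n = Suc m" using assms(2) gr0_implies_Suc by blast
  show "n ^ Suc CARD('b) \<le> K * fact (Suc CARD('b))"
    unfolding K_def n card_exponents_below by (rule power_le_binomial_fact)
  have "K * fact (Suc CARD('b)) \<le> (m + Suc CARD('b)) ^ Suc CARD('b)"
    unfolding K_def n card_exponents_below by (rule binomial_fact_pow)
  then show "K * fact (Suc CARD('b)) \<le> (n + CARD('b)) ^ Suc CARD('b)" by (simp add: n)
qed

section \<open>Averaging the Kakeya bound\<close>

text \<open>
  Each exponent is admitted by at least \<open>P\<close> of the sets, since its node is one of the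
  directions. Summing the multiplicity bound over \<open>\<Omega>\<close> compares the number of exponents below
  \<open>u s\<close> with the number below \<open>2 u - 1\<close>; as \<open>u\<close> grows, the ratio of the two tends to \<open>(s / 2)\<^sup>N\<close>
  with \<open>N = b + 1\<close>.
\<close>

lemma kakeya_average:
  fixes E :: "'m \<Rightarrow> (('a::{field,finite} ^ 'b::finite) \<times> 'a) set" and P :: real
  assumes fin: "finite \<Omega>" and s: "0 < s" "s \<le> CARD('a)"
    and rich: "\<And>d. P \<le> card {M \<in> \<Omega>. \<exists>y. s \<le> card {a. (y + a *s d, a) \<in> E M}}"
  shows "P * real s ^ Suc CARD('b) \<le> 2 ^ Suc CARD('b) * (\<Sum>M\<in>\<Omega>. real (card (E M)))"
proof -
  define N where "N = Suc CARD('b)"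
  define V where "V = (\<Sum>M\<in>\<Omega>. real (card (E M)))"
  define K where "K n = card (exponents_below n :: (('b \<Rightarrow> nat) \<times> nat) set)" for n
  define D where "D M = {d. \<exists>y. s \<le> card {a. (y + a *s d, a) \<in> E M}}" for M
  obtain g :: "nat \<Rightarrow> 'a" where g: "bij_betw g {0..<CARD('a)} UNIV"
    using ex_bij_betw_nat_finite[of "UNIV :: 'a set"] by auto
  then have inj: "inj_on g {..<CARD('a)}" by (simp add: bij_betw_def atLeast0LessThan)
  define f where "f k = g (k mod CARD('a))" for k
  have count: "P * K (u * s) \<le> V * K (2 * u - 1)" for u
  proof -
    let ?X = "exponents_below (u * s) :: (('b \<Rightarrow> nat) \<times> nat) set"
    have "P * K (u * s) = (\<Sum>p\<in>?X. P)" by (simp add: K_def)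
    also have "\<dots> \<le> (\<Sum>p\<in>?X. real (card {M \<in> \<Omega>. node_direction f (fst p) \<in> D M}))"
      by (rule sum_mono) (use rich in \<open>simp add: D_def\<close>)
    also have "\<dots> = real (\<Sum>p\<in>?X. \<Sum>M\<in>\<Omega>. of_bool (node_direction f (fst p) \<in> D M))"
      using fin by (simp add: sum_of_bool_eq Int_def flip: of_nat_sum) 
    also have "\<dots> = real (\<Sum>M\<in>\<Omega>. \<Sum>p\<in>?X. of_bool (node_direction f (fst p) \<in> D M))"
      by (subst sum.swap) (rule refl)
    also have "\<dots> = real (\<Sum>M\<in>\<Omega>. card {p \<in> ?X. node_direction f (fst p) \<in> D M})"
      by (simp add: finite_exponents_below sum_of_bool_eq Int_def)
    also have "\<dots> \<le> real (\<Sum>M\<in>\<Omega>. card (E M) * K (2 * u - 1))"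
    proof (intro of_nat_mono sum_mono)
      fix M
      show "card {p \<in> ?X. node_direction f (fst p) \<in> D M} \<le> card (E M) * K (2 * u - 1)"
        unfolding K_def f_def
        by (rule kakeya_multiplicity_bound[OF inj s(2)]) (simp add: D_def)
    qed
    finally show ?thesis by (simp add: V_def sum_distrib_right)
  qed
  have V0: "0 \<le> V" by (simp add: V_def sum_nonneg)
  \<comment> \<open>the factor \<open>N!\<close> common to both counts cancels\<close>
  have bound: "P * real s ^ N \<le> V * (2 + real N / real u) ^ N" if u: "0 < u" for u
  proof (cases "0 \<le> P")
    case True
    have us: "0 < u * s" "0 < 2 * u - 1" using u s by auto
    have "P * real (u * s) ^ N \<le> P * real (K (u * s) * fact N)"
      using exponents_below_bounds(1)[OF us(1), where 'b='b] True
      by (intro mult_left_mono) (simp_all only: K_def N_def of_nat_le_iff flip: of_nat_power)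
    also have "\<dots> = P * K (u * s) * fact N" by simp
    also have "\<dots> \<le> V * K (2 * u - 1) * fact N" by (intro mult_right_mono count) simp
    also have "\<dots> = V * real (K (2 * u - 1) * fact N)" by simp
    also have "\<dots> \<le> V * real ((2 * u + N) ^ N)"
    proof (intro mult_left_mono V0 of_nat_mono)
      have "K (2 * u - 1) * fact N \<le> (2 * u - 1 + CARD('b)) ^ N"
        unfolding K_def N_def by (rule exponents_below_bounds(2)[OF us(2)])
      also have "\<dots> \<le> (2 * u + N) ^ N" by (intro power_mono) (simp_all add: N_def)
      finally show "K (2 * u - 1) * fact N \<le> (2 * u + N) ^ N" .
    qed
    also have "real ((2 * u + N) ^ N) = real u ^ N * (2 + real N / real u) ^ N"
      using u by (simp add: field_simps flip: power_mult_distrib)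
    finally have "real u ^ N * (P * real s ^ N) \<le> real u ^ N * (V * (2 + real N / real u) ^ N)"
      by (simp add: power_mult_distrib mult_ac)
    then show ?thesis using u by simp
  next
    case False
    then have "P * real s ^ N \<le> 0" by (simp add: mult_nonpos_nonneg)
    also have "0 \<le> V * (2 + real N / real u) ^ N" using V0 by simp
    finally show ?thesis .
  qed
  have "(\<lambda>u. V * (2 + real N * inverse (real u)) ^ N) \<longlonglongrightarrow> V * (2 + real N * 0) ^ N"
    by (intro tendsto_intros lim_inverse_n)
  moreover have "\<exists>n0. \<forall>u\<ge>n0. P * real s ^ N \<le> V * (2 + real N * inverse (real u)) ^ N"
    using bound by (intro exI[of _ 1]) (auto simp: divide_inverse)
  ultimately have "P * real s ^ N \<le> V * (2 + real N * 0) ^ N" by (rule LIMSEQ_le_const)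
  then show ?thesis by (simp add: N_def V_def mult.commute)
qed

section \<open>Second moments of fibres\<close>

text \<open>
  Chebyshev's computation: the sum of the squared fibre sizes counts colliding pairs, and two
  distinct points collide with probability at most \<open>1 / |Y|\<close>, where \<open>Y\<close> is the codomain.
\<close>

lemma fibre_second_moment:
  fixes h :: "'w \<Rightarrow> 'x \<Rightarrow> 'y::finite"
  assumes fin: "finite \<Omega>" "finite T"
    and coll: "\<And>x x'. x \<in> T \<Longrightarrow> x' \<in> T \<Longrightarrow> x \<noteq> x' \<Longrightarrow> card {w \<in> \<Omega>. h w x = h w x'} * CARD('y) \<le> card \<Omega>"
  shows "(\<Sum>w\<in>\<Omega>. \<Sum>y\<in>UNIV. (real (card {x \<in> T. h w x = y}) - real (card T) / real CARD('y))\<^sup>2)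
    \<le> real (card \<Omega>) * real (card T)"
proof -
  define t where "t = real (card T)"
  define Y where "Y = real CARD('y)"
  define k where "k w y = real (card {x \<in> T. h w x = y})" for w y
  have Y: "0 < Y" by (simp add: Y_def)
  have k_sum: "k w y = (\<Sum>x\<in>T. of_bool (h w x = y))" for w y
    using fin by (simp add: k_def sum_of_bool_eq Int_def)
  have k1: "(\<Sum>y\<in>UNIV. k w y) = t" for w
    unfolding k_sum by (subst sum.swap) (simp add: t_def)
  have k2: "(\<Sum>y\<in>UNIV. (k w y)\<^sup>2) = (\<Sum>x\<in>T. \<Sum>x'\<in>T. of_bool (h w x = h w x'))" for w
  proof -
    have "(\<Sum>y\<in>UNIV. (k w y)\<^sup>2) = (\<Sum>y\<in>UNIV. \<Sum>x\<in>T. \<Sum>x'\<in>T. of_bool (h w x = y) * of_bool (h w x' = y))"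
      by (simp add: k_sum power2_eq_square sum_product)
    also have "\<dots> = (\<Sum>x\<in>T. \<Sum>x'\<in>T. \<Sum>y\<in>UNIV. of_bool (h w x = y) * of_bool (h w x' = y))"
      by (subst sum.swap, rule sum.cong[OF refl], subst sum.swap, rule refl)
    also have "\<dots> = (\<Sum>x\<in>T. \<Sum>x'\<in>T. of_bool (h w x = h w x'))"
    proof (intro sum.cong refl)
      fix x x'
      have "(\<Sum>y\<in>UNIV. of_bool (h w x = y) * of_bool (h w x' = y))
        = (\<Sum>y\<in>UNIV. if y = h w x then of_bool (h w x' = h w x) else (0::real))"
        by (intro sum.cong) auto
      then show "(\<Sum>y\<in>UNIV. of_bool (h w x = y) * of_bool (h w x' = y)) = (of_bool (h w x = h w x') :: real)"
        by (simp add: eq_commute)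
    qed
    finally show ?thesis .
  qed
  have var: "(\<Sum>y\<in>UNIV. (k w y - t / Y)\<^sup>2) = (\<Sum>y\<in>UNIV. (k w y)\<^sup>2) - t\<^sup>2 / Y" for w
  proof -
    have "(\<Sum>y\<in>UNIV. (k w y - t / Y)\<^sup>2) = (\<Sum>y\<in>UNIV. (k w y)\<^sup>2 - 2 * (t / Y) * k w y + (t / Y)\<^sup>2)"
      by (simp add: power2_diff algebra_simps)
    also have "\<dots> = (\<Sum>y\<in>UNIV. (k w y)\<^sup>2) - 2 * (t / Y) * t + Y * (t / Y)\<^sup>2"
      by (simp only: sum.distrib sum_subtractf sum_distrib_left[symmetric] k1) (simp add: Y_def)
    also have "\<dots> = (\<Sum>y\<in>UNIV. (k w y)\<^sup>2) - t\<^sup>2 / Y"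
      using Y by (simp add: field_simps power2_eq_square)
    finally show ?thesis .
  qed
  have "(\<Sum>w\<in>\<Omega>. \<Sum>x\<in>T. \<Sum>x'\<in>T. of_bool (h w x = h w x'))
    = (\<Sum>x\<in>T. \<Sum>x'\<in>T. \<Sum>w\<in>\<Omega>. (of_bool (h w x = h w x') :: real))"
    by (subst sum.swap, rule sum.cong[OF refl], subst sum.swap, rule refl)
  also have "\<dots> \<le> (\<Sum>x\<in>T. \<Sum>x'\<in>T. (if x' = x then real (card \<Omega>) else 0) + card \<Omega> / Y)"
  proof (intro sum_mono)
    fix x x' assume x: "x \<in> T" "x' \<in> T"
    show "(\<Sum>w\<in>\<Omega>. of_bool (h w x = h w x')) \<le> (if x' = x then real (card \<Omega>) else 0) + card \<Omega> / Y"
    proof (cases "x' = x")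
      case True
      then show ?thesis using Y by simp
    next
      case False
      have "real (card {w \<in> \<Omega>. h w x = h w x'} * CARD('y)) \<le> real (card \<Omega>)"
        using coll[OF x] False by (intro of_nat_mono) auto
      then have "real (card {w \<in> \<Omega>. h w x = h w x'}) \<le> card \<Omega> / Y"
        using Y by (simp add: field_simps Y_def)
      then show ?thesis using False fin by (simp add: sum_of_bool_eq Int_def)
    qed
  qed
  also have "\<dots> = card \<Omega> * t + t\<^sup>2 * (card \<Omega> / Y)"
    using fin by (simp add: sum.distrib t_def power2_eq_square distrib_left mult_ac)
  finally have "(\<Sum>w\<in>\<Omega>. \<Sum>y\<in>UNIV. (k w y)\<^sup>2) \<le> card \<Omega> * t + t\<^sup>2 * (card \<Omega> / Y)"
    by (simp add: k2)
  then have "(\<Sum>w\<in>\<Omega>. \<Sum>y\<in>UNIV. (k w y - t / Y)\<^sup>2) \<le> card \<Omega> * t"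
    by (simp add: var sum_subtractf mult.commute)
  then show ?thesis by (simp add: k_def t_def Y_def)
qed

text \<open>
  The translates of the kernel by the \<open>r y\<close> are disjoint.
\<close>

lemma card_kernel_of_split_surjection:
  fixes h :: "'w::{ab_group_add,finite} \<Rightarrow> 'y::{ab_group_add,finite}"
  assumes sec: "\<And>w y. h (w + r y) = h w + y"
  shows "card {w. h w = 0} * CARD('y) \<le> CARD('w)"
proof -
  have "inj_on (\<lambda>(w, y). w + r y) ({w. h w = 0} \<times> UNIV)"
  proof (rule inj_onI, clarsimp)
    fix w y w' y' assume h: "h w = 0" "h w' = 0" and eq: "w + r y = w' + r y'"
    have "y = h (w + r y)" "y' = h (w' + r y')" using h by (simp_all add: sec)
    then have "y = y'" using eq by simp
    then show "w = w' \<and> y = y'" using eq by simp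
  qed
  then have "card ({w. h w = 0} \<times> (UNIV :: 'y set)) \<le> CARD('w)"
    by (intro card_inj_on_le[of _ _ UNIV]) auto
  then show ?thesis by (simp add: card_cartesian_product)
qed

section \<open>Random matrices over a finite field\<close>

definition dotp :: "'a::field ^ 'n::finite \<Rightarrow> 'a ^ 'n \<Rightarrow> 'a" where
  "dotp l x = (\<Sum>j\<in>UNIV. l $ j * x $ j)"

lemma matrix_vector_mult_nth_dotp: "(A *v x) $ i = dotp (A $ i) x"
  by (simp add: matrix_vector_mult_def dotp_def)

lemma dotp_diff: "dotp l (x - x') = dotp l x - dotp l x'"
  by (simp add: dotp_def algebra_simps sum_subtractf)

lemma dotp_add_axis:
  assumes "x $ k \<noteq> 0"
  shows "dotp (l + (\<chi> j. if j = k then c / x $ k else 0)) x = dotp l x + c"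
proof -
  have "dotp (l + (\<chi> j. if j = k then c / x $ k else 0)) x
    = (\<Sum>j\<in>UNIV. l $ j * x $ j + (if j = k then c else 0))"
    unfolding dotp_def by (rule sum.cong) (use assms in \<open>auto simp: algebra_simps\<close>)
  then show ?thesis by (simp add: sum.distrib dotp_def)
qed

lemma dotp_collisions:
  fixes x x' :: "'a::{field,finite} ^ 'n::finite"
  assumes "x \<noteq> x'"
  shows "card {l \<in> UNIV. dotp l x = dotp l x'} * CARD('a) \<le> CARD('a ^ 'n)"
proof -
  obtain k where k: "(x - x') $ k \<noteq> 0" using assms by (auto simp: vec_eq_iff)
  have "card {l. dotp l (x - x') = 0} * CARD('a) \<le> CARD('a ^ 'n)"
    by (rule card_kernel_of_split_surjection) (rule dotp_add_axis[OF k])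
  then show ?thesis by (simp add: dotp_diff)
qed

text \<open>
  A random map to \<open>b\<close> coordinates together with one further random functional, that is, a random
  map to dimension \<open>b + 1\<close>, with the last coordinate kept apart.
\<close>

definition extend_map ::
    "('a::field ^ 'n::finite ^ 'b::finite) \<times> ('a ^ 'n) \<Rightarrow> 'a ^ 'n \<Rightarrow> ('a ^ 'b) \<times> 'a" where
  "extend_map M x = (fst M *v x, dotp (snd M) x)"

lemma extend_map_collisions:
  fixes x x' :: "'a::{field,finite} ^ 'n::finite"
  assumes "x \<noteq> x'"
  shows "card {M \<in> (UNIV :: (('a ^ 'n ^ 'b::finite) \<times> ('a ^ 'n)) set). extend_map M x = extend_map M x'} * CARD(('a ^ 'b) \<times> 'a)
    \<le> CARD(('a ^ 'n ^ 'b) \<times> ('a ^ 'n))"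
proof -
  obtain k where k: "(x - x') $ k \<noteq> 0" using assms by (auto simp: vec_eq_iff)
  define ax where "ax c = (\<chi> j. if j = k then c / (x - x') $ k else 0)" for c
  define r where "r z = (\<chi> i. ax (fst z $ i), ax (snd z))" for z :: "('a ^ 'b) \<times> 'a"
  have "card {M :: ('a ^ 'n ^ 'b) \<times> ('a ^ 'n). extend_map M (x - x') = 0} * CARD(('a ^ 'b) \<times> 'a)
      \<le> CARD(('a ^ 'n ^ 'b) \<times> ('a ^ 'n))"
  proof (rule card_kernel_of_split_surjection)
    fix M :: "('a ^ 'n ^ 'b) \<times> ('a ^ 'n)" and z :: "('a ^ 'b) \<times> 'a"
    show "extend_map (M + r z) (x - x') = extend_map M (x - x') + z"
      using dotp_add_axis[OF k]
      by (simp add: extend_map_def r_def prod_eq_iff vec_eq_iff matrix_vector_mult_nth_dotp ax_def del: vector_minus_component)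
  qed
  moreover have "extend_map M (x - x') = 0 \<longleftrightarrow> extend_map M x = extend_map M x'" for M :: "('a ^ 'n ^ 'b) \<times> ('a ^ 'n)"
    by (simp add: extend_map_def prod_eq_iff vec_eq_iff matrix_vector_mult_nth_dotp dotp_diff)
  ultimately show ?thesis by simp
qed

lemma card_left_kernel:
  fixes u :: "'b::finite \<Rightarrow> 'a::{field,finite}"
  assumes "u i0 \<noteq> 0"
  shows "card {A :: 'a ^ 'n::finite ^ 'b. (\<Sum>i\<in>UNIV. u i *s row i A) = 0} * CARD('a ^ 'n) \<le> CARD('a ^ 'n ^ 'b)"
proof (rule card_kernel_of_split_surjection)
  fix A :: "'a ^ 'n ^ 'b" and v :: "'a ^ 'n"
  define R where "R = (\<chi> i. if i = i0 then (1 / u i0) *s v else 0)"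
  have "(\<Sum>i\<in>UNIV. u i *s row i (A + R)) = (\<Sum>i\<in>UNIV. u i *s row i A + (if i = i0 then v else 0))"
    by (rule sum.cong) (use assms in \<open>auto simp: row_def R_def vec_eq_iff algebra_simps\<close>)
  then show "(\<Sum>i\<in>UNIV. u i *s row i (A + (\<chi> i. if i = i0 then (1 / u i0) *s v else 0)))
      = (\<Sum>i\<in>UNIV. u i *s row i A) + v"
    by (simp add: sum.distrib R_def)
qed

text \<open>
  A union bound over the nonzero functionals \<open>u\<close> that might annihilate the image.
\<close>

lemma card_non_surjective_matrices:
  "card {A :: 'a::{field,finite} ^ 'n::finite ^ 'b::finite. \<not> surj ((*v) A)} * CARD('a ^ 'n)
    \<le> CARD('a) ^ CARD('b) * CARD('a ^ 'n ^ 'b)"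
proof -
  define W where "W u = {A :: 'a ^ 'n ^ 'b. (\<Sum>i\<in>UNIV. u i *s row i A) = 0}" for u
  define U where "U = {u :: 'b \<Rightarrow> 'a. u \<noteq> (\<lambda>_. 0)}"
  have "{A :: 'a ^ 'n ^ 'b. \<not> surj ((*v) A)} \<subseteq> (\<Union>u\<in>U. W u)"
    by (auto simp: matrix_right_invertible_surjective[symmetric] matrix_right_invertible_independent_rows
      W_def U_def fun_eq_iff)
  then have "card {A :: 'a ^ 'n ^ 'b. \<not> surj ((*v) A)} \<le> card (\<Union>u\<in>U. W u)"
    by (intro card_mono) auto
  also have "\<dots> \<le> (\<Sum>u\<in>U. card (W u))" by (rule card_UN_le) simp
  finally have "card {A :: 'a ^ 'n ^ 'b. \<not> surj ((*v) A)} * CARD('a ^ 'n) \<le> (\<Sum>u\<in>U. card (W u)) * CARD('a ^ 'n)"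
    by (rule mult_right_mono) simp
  also have "\<dots> = (\<Sum>u\<in>U. card (W u) * CARD('a ^ 'n))" by (rule sum_distrib_right)
  also have "\<dots> \<le> (\<Sum>u\<in>U. CARD('a ^ 'n ^ 'b))"
  proof (rule sum_mono)
    fix u assume "u \<in> U"
    then obtain i0 where "u i0 \<noteq> 0" by (auto simp: U_def)
    then show "card (W u) * CARD('a ^ 'n) \<le> CARD('a ^ 'n ^ 'b)" unfolding W_def by (rule card_left_kernel)
  qed
  also have "\<dots> = card U * CARD('a ^ 'n ^ 'b)" by simp
  also have "\<dots> \<le> CARD('b \<Rightarrow> 'a) * CARD('a ^ 'n ^ 'b)"
    by (intro mult_right_mono card_mono) auto
  finally show ?thesis by (simp add: card_fun)
qed

lemma linear_surjections_eq_matrices: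
  "(linear_surjections :: ('a::{field,finite} ^ 'n::finite \<Rightarrow> 'a ^ 'b::finite) set) = (*v) ` {A. surj ((*v) A)}"
proof
  show "(linear_surjections :: ('a ^ 'n \<Rightarrow> 'a ^ 'b) set) \<subseteq> (*v) ` {A. surj ((*v) A)}"
  proof
    fix L :: "'a ^ 'n \<Rightarrow> 'a ^ 'b" assume L: "L \<in> linear_surjections"
    then have eq: "L = (*v) (matrix L)" by (intro ext) (simp add: linear_surjections_def matrix_works)
    have "surj ((*v) (matrix L))"
      by (subst eq[symmetric]) (use L in \<open>simp add: linear_surjections_def\<close>)
    with eq show "L \<in> (*v) ` {A. surj ((*v) A)}" by (intro image_eqI) auto
  qed
qed (auto simp: linear_surjections_def)

lemma inj_matrix_vector_mult: "inj ((*v) :: 'a::field ^ 'n::finite ^ 'm::finite \<Rightarrow> _)"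
  by (rule injI) (metis matrix_eq)

section \<open>Unbalanced maps\<close>

text \<open>
  A random functional cuts the set \<open>T\<close>, whose size is off by more than \<open>\<tau> \<mu>\<close>, into \<open>q\<close> parts
  which concentrate around \<open>|T| / q\<close>, and this value is itself off from \<open>\<mu> / q\<close> by more than
  \<open>\<tau> \<mu> / q\<close>. So by Chebyshev the expected proportion of parts within \<open>\<tau> \<mu> / (2 q)\<close> of \<open>\<mu> / q\<close> is
  at most \<open>\<eta>\<close>, and by Markov it exceeds \<open>2 \<eta>\<close> for at most half of the functionals.
\<close>

lemma unusual_fibre_has_unusual_parts:
  fixes T :: "('a::{field,finite} ^ 'n::finite) set" and \<mu> \<tau> :: real
  assumes \<mu>: "0 < \<mu>" and \<tau>: "0 < \<tau>" "\<tau> \<le> 1" and T: "\<tau> * \<mu> < \<bar>real (card T) - \<mu>\<bar>"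
  defines "\<eta> \<equiv> 8 * real CARD('a) / (\<tau>\<^sup>2 * \<mu>)"
  shows "real CARD('a ^ 'n) \<le> 2 * real (card {l :: 'a ^ 'n. (1 - 2 * \<eta>) * real CARD('a) \<le>
    real (card {a. \<tau> * \<mu> / (2 * real CARD('a)) \<le> \<bar>real (card {x \<in> T. dotp l x = a}) - \<mu> / real CARD('a)\<bar>})})"
proof -
  define q where "q = real CARD('a)"
  define c where "c = real (card T)"
  define k where "k l a = real (card {x \<in> T. dotp l x = a})" for l a
  define far where "far l = {a. \<tau> * \<mu> / (2 * q) \<le> \<bar>k l a - \<mu> / q\<bar>}" for l
  define near where "near l = {a. \<not> \<tau> * \<mu> / (2 * q) \<le> \<bar>k l a - \<mu> / q\<bar>}" for l
  define G where "G = {l. (1 - 2 * \<eta>) * q \<le> real (card (far l))}"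
  define W where "W = real CARD('a ^ 'n)"
  define \<Delta> where "\<Delta> = \<bar>c - \<mu>\<bar> - \<tau> * \<mu> / 2"
  have q: "0 < q" by (simp add: q_def)
  have \<eta>: "0 < \<eta>" unfolding \<eta>_def using \<mu> \<tau> by simp
  have T': "\<tau> * \<mu> < \<bar>c - \<mu>\<bar>" using T by (simp add: c_def)
  have \<Delta>: "0 < \<Delta>" using T' \<mu> \<tau> mult_pos_pos[of \<tau> \<mu>] unfolding \<Delta>_def by linarith
  \<comment> \<open>a set that is too large also has a larger variance, but its surplus grows faster; \<open>\<tau> \<le> 1\<close> enters here\<close>
  have c_\<Delta>: "c * (\<tau>\<^sup>2 * \<mu>) \<le> 8 * \<Delta>\<^sup>2"
  proof (cases "c \<le> \<mu>")
    case True
    have "\<tau> * \<mu> / 2 \<le> \<Delta>" using T' unfolding \<Delta>_def by linarith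
    then have "(\<tau> * \<mu> / 2)\<^sup>2 \<le> \<Delta>\<^sup>2" using \<mu> \<tau> by (intro power_mono) auto
    moreover have "c * (\<tau>\<^sup>2 * \<mu>) \<le> \<mu> * (\<tau>\<^sup>2 * \<mu>)" using True \<mu> by (intro mult_right_mono) auto
    moreover have "0 \<le> \<mu> * (\<tau>\<^sup>2 * \<mu>)" using \<mu> by simp
    ultimately show ?thesis by (simp add: power2_eq_square field_simps)
  next
    case False
    define \<sigma> where "\<sigma> = c - \<mu>"
    have \<sigma>: "\<tau> * \<mu> < \<sigma>" using T' False by (simp add: \<sigma>_def)
    have \<sigma>0: "0 < \<sigma>" using False by (simp add: \<sigma>_def)
    have "\<sigma> / 2 \<le> \<Delta>" using \<sigma> False by (simp add: \<Delta>_def \<sigma>_def)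
    then have a: "(\<sigma> / 2)\<^sup>2 \<le> \<Delta>\<^sup>2" using \<sigma>0 by (intro power_mono) auto
    have b: "\<mu> * (\<tau>\<^sup>2 * \<mu>) \<le> \<sigma>\<^sup>2"
      using power_mono[of "\<tau> * \<mu>" \<sigma> 2] \<sigma> \<mu> \<tau> by (simp add: power_mult_distrib power2_eq_square mult_ac)
    have "\<tau>\<^sup>2 * \<mu> \<le> \<tau> * \<mu>"
      using \<tau> \<mu> by (intro mult_right_mono) (auto simp: power2_eq_square mult_left_le)
    then have d: "\<sigma> * (\<tau>\<^sup>2 * \<mu>) \<le> \<sigma> * \<sigma>" using \<sigma> \<sigma>0 by (intro mult_left_mono) auto
    have "c * (\<tau>\<^sup>2 * \<mu>) = \<mu> * (\<tau>\<^sup>2 * \<mu>) + \<sigma> * (\<tau>\<^sup>2 * \<mu>)" by (simp add: \<sigma>_def algebra_simps)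
    also have "\<dots> \<le> 2 * \<sigma>\<^sup>2" using b d by (simp add: power2_eq_square)
    also have "\<dots> \<le> 8 * \<Delta>\<^sup>2" using a by (simp add: power_divide)
    finally show ?thesis .
  qed
  have moment: "(\<Sum>l\<in>UNIV. \<Sum>a\<in>UNIV. (k l a - c / q)\<^sup>2) \<le> W * c"
    unfolding k_def c_def q_def W_def by (rule fibre_second_moment) (auto intro: dotp_collisions[simplified])
  have "(\<Sum>l\<in>UNIV. real (card (near l))) * (\<Delta> / q)\<^sup>2 \<le> W * c"
  proof -
    have "(\<Sum>l\<in>UNIV. real (card (near l))) * (\<Delta> / q)\<^sup>2 = (\<Sum>l\<in>UNIV. \<Sum>a\<in>near l. (\<Delta> / q)\<^sup>2)"
      by (simp add: sum_distrib_right)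
    also have "\<dots> \<le> (\<Sum>l\<in>UNIV. \<Sum>a\<in>near l. (k l a - c / q)\<^sup>2)"
    proof (intro sum_mono)
      fix l a assume "a \<in> near l"
      then have near: "\<bar>k l a - \<mu> / q\<bar> \<le> \<tau> * \<mu> / (2 * q)" by (simp add: near_def)
      have "\<bar>c - \<mu>\<bar> / q = \<bar>c / q - \<mu> / q\<bar>" using q by (simp add: diff_divide_distrib[symmetric])
      then have "\<Delta> / q \<le> \<bar>k l a - c / q\<bar>"
        using near unfolding \<Delta>_def diff_divide_distrib by simp
      then show "(\<Delta> / q)\<^sup>2 \<le> (k l a - c / q)\<^sup>2"
        using \<Delta> q by (metis abs_of_pos divide_pos_pos abs_le_square_iff)
    qed
    also have "\<dots> \<le> (\<Sum>l\<in>UNIV. \<Sum>a\<in>UNIV. (k l a - c / q)\<^sup>2)"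
      by (intro sum_mono sum_mono2) auto
    finally show ?thesis using moment by simp
  qed
  then have "((\<Sum>l\<in>UNIV. real (card (near l))) * (\<Delta> / q)\<^sup>2) * (\<tau>\<^sup>2 * \<mu>) \<le> (W * c) * (\<tau>\<^sup>2 * \<mu>)"
    using \<mu> by (intro mult_right_mono) auto
  also have "\<dots> = W * (c * (\<tau>\<^sup>2 * \<mu>))" by simp
  also have "\<dots> \<le> W * (8 * \<Delta>\<^sup>2)" using c_\<Delta> by (intro mult_left_mono) (auto simp: W_def)
  finally have "(\<Sum>l\<in>UNIV. real (card (near l))) * (\<tau>\<^sup>2 * \<mu>) * \<Delta>\<^sup>2 \<le> (8 * W * q\<^sup>2) * \<Delta>\<^sup>2"
    using q by (simp add: field_simps)
  then have "(\<Sum>l\<in>UNIV. real (card (near l))) * (\<tau>\<^sup>2 * \<mu>) \<le> 8 * W * q\<^sup>2"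
    using \<Delta> by (simp add: mult_le_cancel_right)
  then have near_total: "(\<Sum>l\<in>UNIV. real (card (near l))) \<le> \<eta> * q * W"
    using \<mu> \<tau> by (simp add: \<eta>_def q_def[symmetric] field_simps power2_eq_square)
  have compl: "real (card (near l)) = q - real (card (far l))" for l
  proof -
    have "near l = UNIV - far l" by (auto simp: near_def far_def)
    then have "card (near l) = CARD('a) - card (far l)" by (simp add: card_Diff_subset)
    moreover have "card (far l) \<le> CARD('a)" by (intro card_mono) auto
    ultimately show ?thesis by (simp add: q_def of_nat_diff)
  qed
  have "real (card (- G)) * (2 * \<eta> * q) = (\<Sum>l\<in>-G. 2 * \<eta> * q)" by simp
  also have "\<dots> \<le> (\<Sum>l\<in>-G. real (card (near l)))"
    by (rule sum_mono) (auto simp: G_def compl algebra_simps)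
  also have "\<dots> \<le> (\<Sum>l\<in>UNIV. real (card (near l)))" by (rule sum_mono2) auto
  also note near_total
  finally have "(2 * real (card (- G))) * (\<eta> * q) \<le> W * (\<eta> * q)" by (simp add: mult_ac)
  then have "2 * real (card (- G)) \<le> W" using \<eta> q by (simp add: mult_le_cancel_right)
  moreover have "real (card (- G)) = W - real (card G)"
  proof -
    have "card (- G) = CARD('a ^ 'n) - card G" unfolding Compl_eq_Diff_UNIV by (rule card_Diff_subset) auto
    moreover have "card G \<le> CARD('a ^ 'n)" by (intro card_mono) auto
    ultimately show ?thesis unfolding W_def by (simp add: of_nat_diff del: CARD_vec)
  qed
  ultimately have "W \<le> 2 * real (card G)" by simp
  then show ?thesis by (simp only: W_def G_def far_def k_def q_def)
qed

text \<open>
  The loss incurred because rich lines lie only almost entirely inside the exceptional set.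
  Bernoulli's inequality alone is too weak for \<open>N = 2\<close>, which is the case \<open>b = 1\<close>.
\<close>

lemma one_minus_half_power_bound:
  fixes N :: nat
  assumes "2 \<le> N"
  shows "9 / 16 \<le> (1 - 1 / 2 ^ N :: real) ^ N"
proof (cases "N = 2")
  case True
  then show ?thesis by (simp add: power2_eq_square)
next
  case False
  then have "3 \<le> N" using assms by simp
  then have "8 * N \<le> 3 * 2 ^ N"
  proof (induction N rule: dec_induct)
    case (step n)
    then have "8 \<le> 3 * (2::nat) ^ n" by simp
    then show ?case using step by simp
  qed simp
  then have "real (8 * N) \<le> real (3 * 2 ^ N)" by (rule of_nat_mono)
  then have "real N / 2 ^ N \<le> 3 / 8" by (simp add: field_simps)
  moreover have "1 + real N * (- (1 / 2 ^ N)) \<le> (1 + - (1 / 2 ^ N)) ^ N"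
    by (rule Bernoulli_inequality) simp
  ultimately show ?thesis by simp
qed

text \<open>
  For \<open>M = (A, l)\<close> let \<open>E M\<close> be the points of dimension \<open>b + 1\<close> whose fibre in \<open>S\<close> is off from
  \<open>\<mu> / q\<close> by \<open>\<tau> \<mu> / (2 q)\<close>. By the second moment, \<open>E M\<close> is sparse on average. For every
  direction \<open>d\<close>, the shear \<open>(L, l) \<mapsto> (L + d l, l)\<close> permutes the maps \<open>M\<close> and places the fibre of
  \<open>L\<close> over \<open>y\<close> on the line through \<open>(y, 0)\<close> of direction \<open>(d, 1)\<close>. If \<open>L\<close> is unbalanced at \<open>y\<close>,
  then for half of the \<open>l\<close> nearly all of that line lies in \<open>E M\<close>. So unbalanced matrices make
  \<open>E M\<close> a Kakeya set, and the Kakeya bound limits their number.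
\<close>

lemma unbalanced_matrices_bound:
  fixes S :: "('a::{field,finite} ^ 'n::finite) set" and \<tau> \<delta> :: real
  assumes \<tau>: "0 < \<tau>" "\<tau> \<le> 1" and \<delta>: "0 < \<delta>" "\<delta> \<le> 1"
    and large: "mean_fibre S TYPE('b::finite) \<ge> 32 * real CARD('a) * 2 ^ CARD('b) / (\<tau>\<^sup>2 * \<delta>)"
  shows "9 * real (card {A :: 'a ^ 'n ^ 'b. \<not> balanced S \<tau> ((*v) A)}) \<le> 8 * \<delta> * real CARD('a ^ 'n ^ 'b)"
proof -
  define q where "q = real CARD('a)"
  define b where "b = CARD('b)"
  define \<mu> where "\<mu> = mean_fibre S TYPE('b)"
  define \<eta> where "\<eta> = 8 * q / (\<tau>\<^sup>2 * \<mu>)"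
  define Q where "Q = real CARD('a ^ 'n)"
  define R where "R = real CARD('a ^ 'n ^ 'b)"
  define Bad where "Bad = {A :: 'a ^ 'n ^ 'b. \<not> balanced S \<tau> ((*v) A)}"
  have q: "0 < q" by (simp add: q_def)
  have Q: "0 < Q" and R: "0 < R" by (simp_all add: Q_def R_def)
  have card_S: "real (card S) = \<mu> * q ^ b"
    by (simp add: \<mu>_def mean_fibre_def q_def b_def)
  have large': "32 * q * 2 ^ b \<le> \<mu> * (\<tau>\<^sup>2 * \<delta>)"
    using large \<tau> \<delta> by (simp add: \<mu>_def q_def b_def pos_divide_le_eq)
  have \<mu>: "0 < \<mu>"
  proof -
    have "0 < 32 * q * 2 ^ b" using q by simp
    then have "0 < \<mu> * (\<tau>\<^sup>2 * \<delta>)" using large' by linarith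
    then show ?thesis by (rule zero_less_mult_pos2) (use \<tau> \<delta> in simp)
  qed
  have \<tau>\<mu>: "0 < \<tau>\<^sup>2 * \<mu>" using \<tau> \<mu> by simp
  have \<eta>0: "0 < \<eta>" unfolding \<eta>_def using q \<tau>\<mu> by simp
  have \<eta>\<delta>: "4 * 2 ^ b * \<eta> \<le> \<delta>"
    unfolding \<eta>_def using large' \<tau>\<mu> by (simp add: field_simps)
  then have \<eta>1: "2 * \<eta> \<le> 1 / 2 ^ Suc b" using \<delta> by (simp add: field_simps)

  define E where "E M = {z. \<tau> * \<mu> / (2 * q) \<le> \<bar>real (card {x \<in> S. extend_map M x = z}) - \<mu> / q\<bar>}"
    for M :: "('a ^ 'n ^ 'b) \<times> ('a ^ 'n)"
  have E_total: "(\<Sum>M\<in>UNIV. real (card (E M))) * (\<tau> * \<mu> / (2 * q))\<^sup>2 \<le> R * Q * (\<mu> * q ^ b)"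
  proof -
    have mean: "real (card S) / real CARD(('a ^ 'b) \<times> 'a) = \<mu> / q"
      using q by (simp add: card_S q_def b_def)
    have "(\<Sum>M\<in>UNIV. real (card (E M))) * (\<tau> * \<mu> / (2 * q))\<^sup>2 = (\<Sum>M\<in>UNIV. \<Sum>z\<in>E M. (\<tau> * \<mu> / (2 * q))\<^sup>2)"
      by (simp add: sum_distrib_right)
    also have "\<dots> \<le> (\<Sum>M\<in>UNIV. \<Sum>z\<in>E M. (real (card {x \<in> S. extend_map M x = z}) - \<mu> / q)\<^sup>2)"
    proof (intro sum_mono)
      fix M z assume "z \<in> E M"
      then have "\<tau> * \<mu> / (2 * q) \<le> \<bar>real (card {x \<in> S. extend_map M x = z}) - \<mu> / q\<bar>" by (simp add: E_def)
      then have "(\<tau> * \<mu> / (2 * q))\<^sup>2 \<le> \<bar>real (card {x \<in> S. extend_map M x = z}) - \<mu> / q\<bar>\<^sup>2"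
        using \<tau> \<mu> q by (intro power_mono) auto
      then show "(\<tau> * \<mu> / (2 * q))\<^sup>2 \<le> (real (card {x \<in> S. extend_map M x = z}) - \<mu> / q)\<^sup>2" by simp
    qed
    also have "\<dots> \<le> (\<Sum>M\<in>UNIV. \<Sum>z\<in>(UNIV :: (('a ^ 'b) \<times> 'a) set). (real (card {x \<in> S. extend_map M x = z}) - \<mu> / q)\<^sup>2)"
      by (intro sum_mono sum_mono2) auto
    also have "\<dots> \<le> real CARD(('a ^ 'n ^ 'b) \<times> ('a ^ 'n)) * real (card S)"
      unfolding mean[symmetric] by (rule fibre_second_moment) (auto intro: extend_map_collisions[simplified])
    finally show ?thesis by (simp add: card_S R_def Q_def)
  qed

  \<comment> \<open>the number of points of \<open>E M\<close> that a rich line is required to contain\<close>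
  define s where "s = nat \<lceil>(1 - 2 * \<eta>) * q\<rceil>"
  have inv_half: "1 / 2 ^ Suc b \<le> (1 / 2 :: real)" by (simp add: field_simps)
  have half: "2 * \<eta> \<le> 1 / 2" using \<eta>1 inv_half by linarith
  have s_ge: "(1 - 2 * \<eta>) * q \<le> real s" unfolding s_def by linarith
  have s_leI: "s \<le> m" if "(1 - 2 * \<eta>) * q \<le> real m" for m
    using that unfolding s_def by linarith
  have "0 < (1 - 2 * \<eta>) * q" using half q by simp
  then have s0: "0 < s" using s_ge by linarith
  have "(1 - 2 * \<eta>) * q \<le> 1 * q" using \<eta>0 q by (intro mult_right_mono) auto
  then have sq: "s \<le> CARD('a)" by (intro s_leI) (simp add: q_def)

  have "\<forall>L\<in>Bad. \<exists>y. \<tau> * \<mu> < \<bar>real (card {x \<in> S. L *v x = y}) - \<mu>\<bar>"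
  proof
    fix L assume "L \<in> Bad"
    then obtain y where "\<not> ((1 - \<tau>) * \<mu> \<le> real (card (S \<inter> (*v) L -` {y})) \<and>
        real (card (S \<inter> (*v) L -` {y})) \<le> (1 + \<tau>) * \<mu>)"
      by (auto simp: Bad_def balanced_def \<mu>_def)
    moreover have "S \<inter> (*v) L -` {y} = {x \<in> S. L *v x = y}" by auto
    ultimately have "\<tau> * \<mu> < \<bar>real (card {x \<in> S. L *v x = y}) - \<mu>\<bar>"
      by (auto simp: algebra_simps)
    then show "\<exists>y. \<tau> * \<mu> < \<bar>real (card {x \<in> S. L *v x = y}) - \<mu>\<bar>" by blast
  qed
  then obtain Y where Y: "\<And>L. L \<in> Bad \<Longrightarrow> \<tau> * \<mu> < \<bar>real (card {x \<in> S. L *v x = Y L}) - \<mu>\<bar>"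
    by metis
  define far where "far L l = {a. \<tau> * \<mu> / (2 * q) \<le> \<bar>real (card {x \<in> {x \<in> S. L *v x = Y L}. dotp l x = a}) - \<mu> / q\<bar>}"
    for L l
  define Good where "Good L = {l. (1 - 2 * \<eta>) * q \<le> real (card (far L l))}" for L
  have Good: "Q \<le> 2 * real (card (Good L))" if "L \<in> Bad" for L
    using unusual_fibre_has_unusual_parts[OF \<mu> \<tau> Y[OF that]]
    by (simp only: Q_def Good_def far_def \<eta>_def q_def)

  have rich: "real (card Bad) * Q / 2 \<le> real (card {M \<in> UNIV. \<exists>y. s \<le> card {a. (y + a *s d, a) \<in> E M}})" for d
  proof -
    define shear where "shear p = ((\<chi> i. fst p $ i + d $ i *s snd p), snd p)" for p :: "('a ^ 'n ^ 'b) \<times> ('a ^ 'n)"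
    have shear_map: "extend_map (shear (L, l)) x = (L *v x + dotp l x *s d, dotp l x)" for L l x
      by (simp add: extend_map_def shear_def vec_eq_iff matrix_vector_mult_nth_dotp)
        (simp add: dotp_def algebra_simps sum.distrib sum_distrib_left)
    have inj: "inj shear"
      by (rule injI) (auto simp: shear_def prod_eq_iff vec_eq_iff)
    have "shear ` (SIGMA L:Bad. Good L) \<subseteq> {M \<in> UNIV. \<exists>y. s \<le> card {a. (y + a *s d, a) \<in> E M}}"
    proof
      fix M assume "M \<in> shear ` (SIGMA L:Bad. Good L)"
      then obtain L l where L: "L \<in> Bad" and l: "l \<in> Good L" and M: "M = shear (L, l)" by auto
      have "{x \<in> S. extend_map M x = (Y L + a *s d, a)} = {x \<in> {x \<in> S. L *v x = Y L}. dotp l x = a}" for a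
        by (auto simp: M shear_map)
      then have "{a. (Y L + a *s d, a) \<in> E M} = far L l"
        by (simp add: E_def far_def)
      then have "s \<le> card {a. (Y L + a *s d, a) \<in> E M}"
        using l by (simp add: Good_def s_leI)
      then show "M \<in> {M \<in> UNIV. \<exists>y. s \<le> card {a. (y + a *s d, a) \<in> E M}}" by blast
    qed
    then have "card (shear ` (SIGMA L:Bad. Good L)) \<le> card {M \<in> UNIV. \<exists>y. s \<le> card {a. (y + a *s d, a) \<in> E M}}"
      by (intro card_mono) auto
    moreover have "card (shear ` (SIGMA L:Bad. Good L)) = (\<Sum>L\<in>Bad. card (Good L))"
      by (subst card_image) (auto intro: inj_on_subset[OF inj])
    moreover have "real (card Bad) * Q / 2 = (\<Sum>L\<in>Bad. Q / 2)" by simp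
    moreover have "\<dots> \<le> (\<Sum>L\<in>Bad. real (card (Good L)))"
      by (rule sum_mono) (use Good in \<open>simp add: mult.commute\<close>)
    ultimately show ?thesis by (simp flip: of_nat_sum)
  qed

  have "(real (card Bad) * Q / 2) * real s ^ Suc b \<le> 2 ^ Suc b * (\<Sum>M\<in>UNIV. real (card (E M)))"
    unfolding b_def by (rule kakeya_average[OF _ s0 sq]) (simp, rule rich)
  moreover have "9 / 16 * q ^ Suc b \<le> real s ^ Suc b"
  proof -
    have "1 \<le> b" by (simp add: b_def Suc_leI)
    then have "9 / 16 \<le> (1 - 1 / 2 ^ Suc b :: real) ^ Suc b" by (intro one_minus_half_power_bound) simp
    also have "\<dots> \<le> (1 - 2 * \<eta>) ^ Suc b"
      using \<eta>1 inv_half by (intro power_mono) linarith+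
    finally have "9 / 16 * q ^ Suc b \<le> (1 - 2 * \<eta>) ^ Suc b * q ^ Suc b" using q by (intro mult_right_mono) auto
    also have "\<dots> = ((1 - 2 * \<eta>) * q) ^ Suc b" by (simp only: power_mult_distrib)
    also have "\<dots> \<le> real s ^ Suc b" using s_ge half q by (intro power_mono) auto
    finally show ?thesis .
  qed
  then have "(real (card Bad) * Q / 2) * (9 / 16 * q ^ Suc b) \<le> (real (card Bad) * Q / 2) * real s ^ Suc b"
    using Q by (intro mult_left_mono) auto
  ultimately have "(real (card Bad) * Q / 2) * (9 / 16 * q ^ Suc b) \<le> 2 ^ Suc b * (\<Sum>M\<in>UNIV. real (card (E M)))"
    by linarith
  then have "(real (card Bad) * Q / 2) * (9 / 16 * q ^ Suc b) * (\<tau> * \<mu> / (2 * q))\<^sup>2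
      \<le> 2 ^ Suc b * (\<Sum>M\<in>UNIV. real (card (E M))) * (\<tau> * \<mu> / (2 * q))\<^sup>2"
    by (rule mult_right_mono) simp
  also have "\<dots> \<le> 2 ^ Suc b * (R * Q * (\<mu> * q ^ b))"
    using E_total by (simp add: mult.assoc)
  finally have "(Q * q ^ b * \<mu> / q) * (9 * real (card Bad) * (\<tau>\<^sup>2 * \<mu>)) \<le> (Q * q ^ b * \<mu> / q) * (256 * (2 ^ b * q * R))"
    using q by (simp add: field_simps power2_eq_square)
  then have "9 * real (card Bad) * (\<tau>\<^sup>2 * \<mu>) \<le> 256 * (2 ^ b * q * R)"
    by (rule mult_left_le_imp_le) (use Q q \<mu> in simp)
  also have "\<dots> = 8 * (32 * q * 2 ^ b) * R" by simp
  also have "\<dots> \<le> 8 * (\<mu> * (\<tau>\<^sup>2 * \<delta>)) * R"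
    using large' R by (intro mult_right_mono mult_left_mono) auto
  finally have "9 * real (card Bad) * (\<tau>\<^sup>2 * \<mu>) \<le> (8 * \<delta> * R) * (\<tau>\<^sup>2 * \<mu>)" by (simp add: mult_ac)
  then have "9 * real (card Bad) \<le> 8 * \<delta> * R" using \<tau>\<mu> by (rule mult_right_le_imp_le)
  then show ?thesis by (simp only: Bad_def R_def)
qed

theorem corollary1p1:
  fixes S :: "('a::{field,finite} ^ 'n::finite) set"
    and \<tau> \<delta> :: real
  assumes "S \<noteq> {}"
    and "1 \<le> CARD('b::finite)" and "CARD('b) \<le> CARD('n)"
    and "0 < \<tau>" and "\<tau> \<le> 1"
    and "0 < \<delta>" and "\<delta> < 1"
    and "mean_fibre S TYPE('b) \<ge> 32 * real CARD('a) * 2 ^ CARD('b) / (\<tau>\<^sup>2 * \<delta>)"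
  shows "unbalanced_proportion S TYPE('b) \<tau> < \<delta> \<and>
    measure_pmf.prob (pmf_of_set (UNIV :: ('a ^ 'n ^ 'b) set))
      {A. \<not> balanced S \<tau> ((*v) A)} < \<delta>"
proof -
  define R where "R = real CARD('a ^ 'n ^ 'b)"
  define Bad where "Bad = {A :: 'a ^ 'n ^ 'b. \<not> balanced S \<tau> ((*v) A)}"
  define Surj where "Surj = {A :: 'a ^ 'n ^ 'b. surj ((*v) A)}"
  have R: "0 < R" by (simp add: R_def)
  have "9 * real (card Bad) \<le> 8 * \<delta> * R"
    unfolding Bad_def R_def using assms(4-8) by (intro unbalanced_matrices_bound) auto
  then have bad: "real (card Bad) \<le> 8 / 9 * \<delta> * R" by simp
  have \<delta>R: "0 < \<delta> * R" using R assms by simp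

  have prob: "measure_pmf.prob (pmf_of_set (UNIV :: ('a ^ 'n ^ 'b) set)) Bad < \<delta>"
  proof -
    have "measure_pmf.prob (pmf_of_set (UNIV :: ('a ^ 'n ^ 'b) set)) Bad = real (card Bad) / R"
      by (subst measure_pmf_of_set) (auto simp: R_def)
    also have "\<dots> < \<delta>" using bad R \<delta>R by (subst pos_divide_less_eq) linarith+
    finally show ?thesis .
  qed

  \<comment> \<open>a large \<open>\<mu>\<close> forces \<open>q\<^sup>n \<ge> 64 q\<^sup>b\<close>, so almost all matrices are surjective and the loss is absorbed
    by the factor \<open>8 / 9\<close>\<close>
  have non_surj: "64 * real (card (- Surj)) \<le> R"
  proof -
    define q where "q = real CARD('a)"
    define Q where "Q = real CARD('a ^ 'n)"
    have q: "1 \<le> q" by (simp add: q_def Suc_leI)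
    have "card (- Surj) * CARD('a ^ 'n) \<le> CARD('a) ^ CARD('b) * CARD('a ^ 'n ^ 'b)"
      using card_non_surjective_matrices[where 'a='a and 'n='n and 'b='b]
      by (simp only: Surj_def Collect_neg_eq)
    then have "real (card (- Surj) * CARD('a ^ 'n)) \<le> real (CARD('a) ^ CARD('b) * CARD('a ^ 'n ^ 'b))"
      by (rule of_nat_mono)
    then have le: "real (card (- Surj)) * Q \<le> q ^ CARD('b) * R"
      by (simp only: of_nat_mult of_nat_power q_def Q_def R_def)
    have "\<tau>\<^sup>2 * \<delta> \<le> 1 * 1" using assms by (intro mult_mono) (auto simp: power_le_one)
    moreover have "0 < \<tau>\<^sup>2 * \<delta>" using assms by simp
    ultimately have "64 \<le> 64 / (\<tau>\<^sup>2 * \<delta>)" by (simp add: field_simps)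
    also have "\<dots> \<le> 32 * q * 2 ^ CARD('b) / (\<tau>\<^sup>2 * \<delta>)"
    proof (rule divide_right_mono)
      have "1 * 2 \<le> q * 2 ^ CARD('b)"
        using q assms(2) power_increasing[of 1 "CARD('b)" "2::real"] by (intro mult_mono) auto
      then show "64 \<le> 32 * q * 2 ^ CARD('b)" by simp
    qed (use assms in simp)
    also have "\<dots> \<le> mean_fibre S TYPE('b)" using assms(8) by (simp only: q_def)
    finally have "64 * q ^ CARD('b) \<le> mean_fibre S TYPE('b) * q ^ CARD('b)"
      using q by (intro mult_right_mono) auto
    also have "\<dots> = real (card S)" using q by (simp add: mean_fibre_def q_def)
    also have "\<dots> \<le> Q" unfolding Q_def by (intro of_nat_mono card_mono) auto
    finally have "64 * q ^ CARD('b) * real (card (- Surj)) \<le> Q * real (card (- Surj))"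
      by (rule mult_right_mono) simp
    also have "\<dots> \<le> q ^ CARD('b) * R" using le by (simp add: mult.commute)
    finally have "q ^ CARD('b) * (64 * real (card (- Surj))) \<le> q ^ CARD('b) * R" by (simp add: mult_ac)
    then show ?thesis by (rule mult_left_le_imp_le) (use q in simp)
  qed
  have "real (card (- Surj)) = R - real (card Surj)"
  proof -
    have "card (- Surj) = CARD('a ^ 'n ^ 'b) - card Surj"
      unfolding Compl_eq_Diff_UNIV by (rule card_Diff_subset) auto
    moreover have "card Surj \<le> CARD('a ^ 'n ^ 'b)" by (intro card_mono) auto
    ultimately show ?thesis unfolding R_def by (simp add: of_nat_diff del: CARD_vec)
  qed
  then have surj: "63 / 64 * R \<le> real (card Surj)" using non_surj by linarith

  have "unbalanced_proportion S TYPE('b) \<tau> < \<delta>"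
  proof -
    let ?L = "linear_surjections :: ('a ^ 'n \<Rightarrow> 'a ^ 'b) set"
    have inj: "inj_on (*v) X" for X :: "('a ^ 'n ^ 'b) set"
      using inj_matrix_vector_mult by (rule inj_on_subset) simp
    have "card ?L = card Surj"
      unfolding linear_surjections_eq_matrices Surj_def by (rule card_image) (rule inj)
    moreover have "card {L \<in> ?L. \<not> balanced S \<tau> L} \<le> card ((*v) ` Bad)"
      by (rule card_mono) (auto simp: linear_surjections_eq_matrices Bad_def)
    moreover have "card ((*v) ` Bad) = card Bad" by (rule card_image) (rule inj)
    ultimately have "unbalanced_proportion S TYPE('b) \<tau> \<le> real (card Bad) / real (card Surj)"
      by (simp add: unbalanced_proportion_def divide_right_mono)
    also have "\<dots> < \<delta>"
    proof -
      have "real (card Bad) \<le> 8 / 9 * (\<delta> * R)" using bad by simp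
      also have "\<dots> < 63 / 64 * (\<delta> * R)" using \<delta>R by (intro mult_strict_right_mono) auto
      also have "\<dots> = \<delta> * (63 / 64 * R)" by simp
      also have "\<dots> \<le> \<delta> * real (card Surj)" using surj assms by (intro mult_left_mono) auto
      finally show ?thesis using surj R by (subst pos_divide_less_eq) auto
    qed
    finally show ?thesis .
  qed
  then show ?thesis using prob by (simp only: Bad_def)
qed

end
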